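(* Let $(\mathfrak l,\theta_{\mathfrak l})$ be a Lie algebra with involution and let $\mathfrak a$ be an orthogonal $(\mathfrak l,\theta_{\mathfrak l})$-module. Then the equivalence classes of quadratic extensions of $(\mathfrak l,\theta_{\mathfrak l})$ by $\mathfrak a$ are in one-to-one correspondence with the elements of $\mathcal H^2_Q(\mathfrak l,\theta_{\mathfrak l},\mathfrak a)$; the correspondence assigns to $[\alpha,\gamma]\in\mathcal H^2_Q(\mathfrak l,\theta_{\mathfrak l},\mathfrak a)$ the equivalence class of the quadratic extension $\mathfrak d_{\alpha,\gamma}(\mathfrak l,\theta_{\mathfrak l},\mathfrak a)$.
   Context: All Lie algebras and vector spaces are finite-dimensional over $\mathbb R$; a scalar product is a non-degenerate symmetric bilinear form, possibly indefinite. A Lie algebra with involution is a pair $(\mathfrak l,\theta_{\mathfrak l})$, $\theta_{\mathfrak l}\in\mathrm{Aut}(\mathfrak l)$, $\theta_{\mathfrak l}^2=\mathrm{Id}$; homomorphisms commute with the involutions. Subscripts $\pm$ denote $\pm1$-eigenspaces of an involution. A metric Lie algebra with involution $(\mathfrak g,\theta)$ is a Lie algebra with ad-invariant scalar product $\langle\cdot,\cdot\rangle$ and an isometric involutive automorphism $\theta$; isomorphisms of these are isometric and commute with the involutions. **Modules and quadratic cohomology.** An orthogonal $(\mathfrak l,\theta_{\mathfrak l})$-module is $(\rho,\mathfrak a,\langle\cdot,\cdot\rangle_{\mathfrak a},\theta_{\mathfrak a})$ with $\rho$ a representation of $\mathfrak l$ on $\mathfrak a$ by skew-adjoint maps and $\theta_{\mathfrak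 a}$ an involutive isometry with $\theta_{\mathfrak a}\circ\rho(\theta_{\mathfrak l}(L))=\rho(L)\circ\theta_{\mathfrak a}$ for all $L\in\mathfrak l$. $C^p(\mathfrak l,\mathfrak a)=\mathrm{Hom}(\bigwedge^p\mathfrak l,\mathfrak a)$ and $C^p(\mathfrak l)=\mathrm{Hom}(\bigwedge^p\mathfrak l,\mathbb R)$ carry the Chevalley–Eilenberg differentials $d$; $\langle\alpha\wedge\tau\rangle\in C^{p+q}(\mathfrak l)$ is the (shuffle) wedge product of $\alpha\in C^p(\mathfrak l,\mathfrak a)$, $\tau\in C^q(\mathfrak l,\mathfrak a)$ composed with $\langle\cdot,\cdot\rangle_{\mathfrak a}$. The involution $\Theta$ is $(\Theta\alpha)(L_1,\dots)=\theta_{\mathfrak a}(\alpha(\theta_{\mathfrak l}L_1,\dots))$ on $C^p(\mathfrak l,\mathfrak a)$ and $(\Theta\gamma)(L_1,\dots)=\gamma(\theta_{\mathfrak l}L_1,\dots)$ on $C^p(\mathfrak l)$. Put $\mathcal Z^2_Q(\mathfrak l,\mathfrak a)_+=\{(\alpha,\gamma)\in C^2(\mathfrak l,\mathfrak a)_+\oplus C^3(\mathfrak l)_+\mid d\alpha=0,\ d\gamma=\frac12\langle\alpha\wedge\alpha\rangle\}$. The group $\mathcal C^1_Q(\mathfrak l,\mathfrak a)_+=C^1(\mathfrak l,\mathfrak a)_+\oplus C^2(\mathfrak l)_+$ with product $(\tau_1,\sigma_1)*(\tau_2,\sigma_2)=(\tau_1+\tau_2,\sigma_1+\sigma_2+\frac12\langle\tau_1\wedge\tau_2\rangle)$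 acts on it by $(\alpha,\gamma)(\tau,\sigma)=(\alpha+d\tau,\ \gamma+d\sigma+\langle(\alpha+\frac12d\tau)\wedge\tau\rangle)$, and $\mathcal H^2_Q(\mathfrak l,\theta_{\mathfrak l},\mathfrak a)$ is the set of orbits $[\alpha,\gamma]$. **Quadratic extensions.** A quadratic extension of $(\mathfrak l,\theta_{\mathfrak l})$ by $\mathfrak a$ is a tuple $(\mathfrak g,\theta,\mathfrak i,i,p)$ where $(\mathfrak g,\theta)$ is a metric Lie algebra with involution, $\mathfrak i\subset\mathfrak g$ is a $\theta$-invariant isotropic ideal, and $0\to\mathfrak a\xrightarrow{i}\mathfrak g/\mathfrak i\xrightarrow{p}\mathfrak l\to0$ is an exact sequence of Lie algebras with involution ($\mathfrak a$ abelian) such that $i(\rho(L)A)=[\tilde L,i(A)]$ whenever $\tilde L\in\mathfrak g/\mathfrak i$, $p(\tilde L)=L$, and $i$ is an isometry from $\mathfrak a$ onto $\mathfrak i^\perp/\mathfrak i$. Two quadratic extensions $(\mathfrak g_j,\theta_j,\mathfrak i_j,i_j,p_j)$, $j=1,2$, are equivalent if there is an isomorphism of metric Lie algebras with involution $\Psi:\mathfrak g_1\to\mathfrak g_2$ with $\Psi(\mathfrak i_1)=\mathfrak i_2$ whose induced map $\overline\Psi:\mathfrak g_1/\mathfrak i_1\to\mathfrak g_2/\mathfrak i_2$ satisfies $\overline\Psi\circ i_1=i_2$, $p_2\circ\overline\Psi=p_1$. **Standard model.** For $(\alpha,\gamma)\in\mathcal Z^2_Q(\mathfrak l,\mathfrak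 a)_+$, $\mathfrak d_{\alpha,\gamma}(\mathfrak l,\theta_{\mathfrak l},\mathfrak a)$ is the vector space $\mathfrak d=\mathfrak l^*\oplus\mathfrak a\oplus\mathfrak l$ with $\langle Z_1+A_1+L_1,Z_2+A_2+L_2\rangle=\langle A_1,A_2\rangle_{\mathfrak a}+Z_1(L_2)+Z_2(L_1)$, $\theta=\theta_{\mathfrak l}^*\oplus\theta_{\mathfrak a}\oplus\theta_{\mathfrak l}$ and antisymmetric bracket $[\mathfrak l^*,\mathfrak l^*\oplus\mathfrak a]=0$, $[L_1,L_2]=\gamma(L_1,L_2,\cdot)+\alpha(L_1,L_2)+[L_1,L_2]_{\mathfrak l}$, $[L,A]=\rho(L)A-\langle A,\alpha(L,\cdot)\rangle_{\mathfrak a}$, $[L,Z]=-Z([L,\cdot]_{\mathfrak l})$, $[A_1,A_2]=\langle\rho(\cdot)A_1,A_2\rangle_{\mathfrak a}$. It is a quadratic extension with $\mathfrak i=\mathfrak l^*$, $i:\mathfrak a\to\mathfrak a\oplus\mathfrak l\cong\mathfrak d/\mathfrak l^*$ the injection and $p:\mathfrak a\oplus\mathfrak l\to\mathfrak l$ the projection. *)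

theory Defs
  imports "HOL-Analysis.Analysis"
begin

section \<open>Lie algebras with involution and orthogonal modules\<close>

text \<open>
  A vector space is a type of class \<^class>\<open>real_vector\<close> (not \<^class>\<open>euclidean_space\<close>, which would
  exclude dimension 0) that satisfies the following predicate.
\<close>

definition fin_dim :: "'v::real_vector itself \<Rightarrow> bool" where
  "fin_dim _ \<longleftrightarrow> (\<exists>B :: 'v set. finite B \<and> span B = UNIV)"

locale scalar_product =
  fixes ip :: "'v::real_vector \<Rightarrow> 'v \<Rightarrow> real"
  assumes ip_bilinear: "bilinear ip"
    and ip_sym: "ip x y = ip y x"
    and ip_nondegenerate: "(\<And>y. ip x y = 0) \<Longrightarrow> x = 0"

locale lie_algebra =
  fixes br :: "'l::real_vector \<Rightarrow> 'l \<Rightarrow> 'l"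
  assumes lie_fin_dim: "fin_dim TYPE('l)"
    and br_bilinear: "bilinear br"
    and br_alternating: "br x x = 0"
    and br_jacobi: "br x (br y z) + br y (br z x) + br z (br x y) = 0"

locale lie_algebra_inv = lie_algebra br
  for br :: "'l::real_vector \<Rightarrow> 'l \<Rightarrow> 'l" +
  fixes \<theta> :: "'l \<Rightarrow> 'l"
  assumes inv_linear: "linear \<theta>"
    and inv_br: "\<theta> (br x y) = br (\<theta> x) (\<theta> y)"
    and inv_inv: "\<theta> (\<theta> x) = x"

locale metric_lie_algebra_inv = lie_algebra_inv br \<theta> + scalar_product ip
  for br :: "'g::real_vector \<Rightarrow> 'g \<Rightarrow> 'g"
    and ip :: "'g \<Rightarrow> 'g \<Rightarrow> real"
    and \<theta> :: "'g \<Rightarrow> 'g" +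
  assumes ip_invariant: "ip (br x y) z + ip y (br x z) = 0"
    and inv_isometry: "ip (\<theta> x) (\<theta> y) = ip x y"

locale orthogonal_module = L: lie_algebra_inv brl \<theta>l + A: scalar_product ip
  for brl :: "'l::real_vector \<Rightarrow> 'l \<Rightarrow> 'l"
    and \<theta>l :: "'l \<Rightarrow> 'l"
    and ip :: "'a::real_vector \<Rightarrow> 'a \<Rightarrow> real" +
  fixes \<rho> :: "'l \<Rightarrow> 'a \<Rightarrow> 'a"
    and \<theta>a :: "'a \<Rightarrow> 'a"
  assumes mod_fin_dim: "fin_dim TYPE('a)"
    and rep_bilinear: "bilinear \<rho>"
    and rep_br: "\<rho> (brl x y) u = \<rho> x (\<rho> y u) - \<rho> y (\<rho> x u)"
    and rep_skew: "ip (\<rho> x u) v = - ip u (\<rho> x v)"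
    and mod_inv_linear: "linear \<theta>a"
    and mod_inv_inv: "\<theta>a (\<theta>a u) = u"
    and mod_inv_isometry: "ip (\<theta>a u) (\<theta>a v) = ip u v"
    and mod_inv_rep: "\<theta>a (\<rho> (\<theta>l x) u) = \<rho> x (\<theta>a u)"


section \<open>Cochains\<close>

text \<open>
  A \<open>p\<close>-cochain is an alternating multilinear function of lists of length \<open>p\<close>, extended by 0 to
  lists of any other length.
\<close>

definition cochains :: "nat \<Rightarrow> ('l::real_vector list \<Rightarrow> 'v::real_vector) set" where
  "cochains p = {f.
     (\<forall>xs. length xs \<noteq> p \<longrightarrow> f xs = 0) \<and>
     (\<forall>xs i. length xs = p \<and> i < p \<longrightarrow> linear (\<lambda>x. f (xs[i := x]))) \<and>
     (\<forall>xs. length xs = p \<and> \<not> distinct xs \<longrightarrow> f xs = 0)}"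

text \<open>
  The differential
  \<open>(d f)(x\<^sub>0,\<dots>,x\<^sub>p) = \<Sum>\<^sub>i (-1)\<^sup>i \<rho>(x\<^sub>i) f(\<dots>,x\<^sub>i omitted,\<dots>)
     + \<Sum>\<^bsub>i<j\<^esub> (-1)\<^bsup>i+j\<^esup> f([x\<^sub>i,x\<^sub>j],\<dots>,x\<^sub>i,x\<^sub>j omitted,\<dots>)\<close>.
\<close>

definition ce_diff ::
  "('l \<Rightarrow> 'l \<Rightarrow> 'l) \<Rightarrow> ('l \<Rightarrow> 'v \<Rightarrow> 'v) \<Rightarrow> ('l list \<Rightarrow> 'v) \<Rightarrow> 'l list \<Rightarrow> 'v::real_vector" where
  "ce_diff br \<rho> f xs =
     (\<Sum>i<length xs. (-1) ^ i *\<^sub>R \<rho> (xs ! i) (f (nths xs (- {i})))) +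
     (\<Sum>j<length xs. \<Sum>i<j. (-1) ^ (i + j) *\<^sub>R f (br (xs ! i) (xs ! j) # nths xs (- {i, j})))"

abbreviation ce_diff_triv ::
  "('l \<Rightarrow> 'l \<Rightarrow> 'l) \<Rightarrow> ('l list \<Rightarrow> real) \<Rightarrow> 'l list \<Rightarrow> real" where
  "ce_diff_triv br \<equiv> ce_diff br (\<lambda>_ _. 0)"

text \<open>
  The wedge product as a sum over shuffles.  A \<open>(p,q)\<close>-shuffle is determined by the set \<open>S\<close> of the
  \<open>p\<close> positions whose entries go to the first factor; sets \<open>S\<close> of other sizes contribute 0, because
  a \<open>p\<close>-cochain vanishes on lists of length different from \<open>p\<close>.
\<close>

definition shuffle_sign :: "nat \<Rightarrow> nat set \<Rightarrow> real" where
  "shuffle_sign n S = (-1) ^ card {(i, j). i \<in> S \<and> j \<in> {..<n} - S \<and> j < i}"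

definition wedge ::
  "('a \<Rightarrow> 'a \<Rightarrow> real) \<Rightarrow> ('l list \<Rightarrow> 'a) \<Rightarrow> ('l list \<Rightarrow> 'a) \<Rightarrow> 'l list \<Rightarrow> real" where
  "wedge ip \<alpha> \<tau> xs =
     (\<Sum>S \<in> Pow {..<length xs}.
        shuffle_sign (length xs) S * ip (\<alpha> (nths xs S)) (\<tau> (nths xs (- S))))"

definition cochain_inv ::
  "('l \<Rightarrow> 'l) \<Rightarrow> ('v \<Rightarrow> 'v) \<Rightarrow> ('l list \<Rightarrow> 'v) \<Rightarrow> 'l list \<Rightarrow> 'v" where
  "cochain_inv \<theta>l \<theta>v f xs = \<theta>v (f (map \<theta>l xs))"

definition cochains_plus ::
  "('l \<Rightarrow> 'l) \<Rightarrow> ('v \<Rightarrow> 'v) \<Rightarrow> nat \<Rightarrow> ('l::real_vector list \<Rightarrow> 'v::real_vector) set" where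
  "cochains_plus \<theta>l \<theta>v p = {f \<in> cochains p. cochain_inv \<theta>l \<theta>v f = f}"


section \<open>Quadratic cohomology\<close>

definition Z2Q ::
  "('l::real_vector \<Rightarrow> 'l \<Rightarrow> 'l) \<Rightarrow> ('l \<Rightarrow> 'l) \<Rightarrow> ('a::real_vector \<Rightarrow> 'a \<Rightarrow> real) \<Rightarrow>
   ('l \<Rightarrow> 'a \<Rightarrow> 'a) \<Rightarrow> ('a \<Rightarrow> 'a) \<Rightarrow> (('l list \<Rightarrow> 'a) \<times> ('l list \<Rightarrow> real)) set" where
  "Z2Q br \<theta>l ip \<rho> \<theta>a = {(\<alpha>, \<gamma>).
     \<alpha> \<in> cochains_plus \<theta>l \<theta>a 2 \<and> \<gamma> \<in> cochains_plus \<theta>l id 3 \<and>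
     ce_diff br \<rho> \<alpha> = (\<lambda>_. 0) \<and>
     ce_diff_triv br \<gamma> = (\<lambda>xs. (1/2) * wedge ip \<alpha> \<alpha> xs)}"

definition C1Q ::
  "('l::real_vector \<Rightarrow> 'l) \<Rightarrow> ('a::real_vector \<Rightarrow> 'a) \<Rightarrow>
   (('l list \<Rightarrow> 'a) \<times> ('l list \<Rightarrow> real)) set" where
  "C1Q \<theta>l \<theta>a = cochains_plus \<theta>l \<theta>a 1 \<times> cochains_plus \<theta>l id 2"

definition C1Q_act ::
  "('l::real_vector \<Rightarrow> 'l \<Rightarrow> 'l) \<Rightarrow> ('a::real_vector \<Rightarrow> 'a \<Rightarrow> real) \<Rightarrow> ('l \<Rightarrow> 'a \<Rightarrow> 'a) \<Rightarrow>
   ('l list \<Rightarrow> 'a) \<times> ('l list \<Rightarrow> real) \<Rightarrow> ('l list \<Rightarrow> 'a) \<times> ('l list \<Rightarrow> real) \<Rightarrow>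
   ('l list \<Rightarrow> 'a) \<times> ('l list \<Rightarrow> real)" where
  "C1Q_act br ip \<rho> = (\<lambda>(\<alpha>, \<gamma>) (\<tau>, \<sigma>).
     ((\<lambda>xs. \<alpha> xs + ce_diff br \<rho> \<tau> xs),
      (\<lambda>xs. \<gamma> xs + ce_diff_triv br \<sigma> xs +
         wedge ip (\<lambda>ys. \<alpha> ys + (1/2) *\<^sub>R ce_diff br \<rho> \<tau> ys) \<tau> xs)))"

definition orbit_rel where
  "orbit_rel br \<theta>l ip \<rho> \<theta>a =
     {(z, C1Q_act br ip \<rho> z c) | z c. z \<in> Z2Q br \<theta>l ip \<rho> \<theta>a \<and> c \<in> C1Q \<theta>l \<theta>a}"

definition H2Q where
  "H2Q br \<theta>l ip \<rho> \<theta>a = Z2Q br \<theta>l ip \<rho> \<theta>a // orbit_rel br \<theta>l ip \<rho> \<theta>a"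


section \<open>Quotients by an ideal\<close>

text \<open>
  The elements of the quotient are the cosets; the operations are the images of the operations
  of the ambient space, thickened by \<open>I\<close> where the image is not yet a full coset.
\<close>

definition coset :: "'g::real_vector set \<Rightarrow> 'g \<Rightarrow> 'g set" where
  "coset I x = {x + z | z. z \<in> I}"

definition quot :: "'g::real_vector set \<Rightarrow> 'g set set" where
  "quot I = range (coset I)"

definition quot_add :: "'g::real_vector set \<Rightarrow> 'g set \<Rightarrow> 'g set" where
  "quot_add X Y = {x + y | x y. x \<in> X \<and> y \<in> Y}"

definition quot_scale :: "'g::real_vector set \<Rightarrow> real \<Rightarrow> 'g set \<Rightarrow> 'g set" where
  "quot_scale I c X = {c *\<^sub>R x + z | x z. x \<in> X \<and> z \<in> I}"

definition quot_br :: "('g::real_vector \<Rightarrow> 'g \<Rightarrow> 'g) \<Rightarrow> 'g set \<Rightarrow> 'g set \<Rightarrow> 'g set \<Rightarrow> 'g set" where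
  "quot_br br I X Y = {br x y + z | x y z. x \<in> X \<and> y \<in> Y \<and> z \<in> I}"

definition orth_compl :: "('g \<Rightarrow> 'g \<Rightarrow> real) \<Rightarrow> 'g set \<Rightarrow> 'g set" where
  "orth_compl ip I = {x. \<forall>y\<in>I. ip x y = 0}"


section \<open>Quadratic extensions\<close>

record ('g, 'a, 'l) quad_ext =
  qbr :: "'g \<Rightarrow> 'g \<Rightarrow> 'g"
  qip :: "'g \<Rightarrow> 'g \<Rightarrow> real"
  qinv :: "'g \<Rightarrow> 'g"
  qideal :: "'g set"
  qinj :: "'a \<Rightarrow> 'g set"
  qproj :: "'g set \<Rightarrow> 'l"

text \<open>
  \<open>qproj\<close> is only constrained on the quotient by \<open>qideal\<close>; its other values are irrelevant.
  The module \<open>a\<close> is an abelian Lie algebra, so \<open>i\<close> preserving brackets means \<open>[i A, i B] = i 0\<close>.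
  The last clause of the definition states that \<open>i\<close> preserves the scalar product that the quotient
  of the orthogonal complement inherits from \<open>g\<close>.
\<close>

definition is_quad_ext ::
  "('l::real_vector \<Rightarrow> 'l \<Rightarrow> 'l) \<Rightarrow> ('l \<Rightarrow> 'l) \<Rightarrow> ('a::real_vector \<Rightarrow> 'a \<Rightarrow> real) \<Rightarrow>
   ('l \<Rightarrow> 'a \<Rightarrow> 'a) \<Rightarrow> ('a \<Rightarrow> 'a) \<Rightarrow> ('g::real_vector, 'a, 'l) quad_ext \<Rightarrow> bool" where
  "is_quad_ext brl \<theta>l ip \<rho> \<theta>a E \<longleftrightarrow>
     (let br = qbr E; ipg = qip E; \<theta> = qinv E; I = qideal E; i = qinj E; p = qproj E in
      metric_lie_algebra_inv br ipg \<theta> \<and>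
      subspace I \<and> (\<forall>x. \<forall>y\<in>I. br x y \<in> I) \<and> \<theta> ` I \<subseteq> I \<and> (\<forall>x\<in>I. \<forall>y\<in>I. ipg x y = 0) \<and>
      (\<forall>A. i A \<in> quot I) \<and>
      (\<forall>A B. i (A + B) = quot_add (i A) (i B)) \<and>
      (\<forall>c A. i (c *\<^sub>R A) = quot_scale I c (i A)) \<and>
      (\<forall>A B. quot_br br I (i A) (i B) = i 0) \<and>
      (\<forall>A. i (\<theta>a A) = \<theta> ` (i A)) \<and>
      (\<forall>X\<in>quot I. \<forall>Y\<in>quot I. p (quot_add X Y) = p X + p Y) \<and>
      (\<forall>c. \<forall>X\<in>quot I. p (quot_scale I c X) = c *\<^sub>R p X) \<and>
      (\<forall>X\<in>quot I. \<forall>Y\<in>quot I. p (quot_br br I X Y) = brl (p X) (p Y)) \<and>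
      (\<forall>X\<in>quot I. p (\<theta> ` X) = \<theta>l (p X)) \<and>
      inj i \<and> range i = {X \<in> quot I. p X = 0} \<and> p ` quot I = UNIV \<and>
      (\<forall>L A. \<forall>X\<in>quot I. p X = L \<longrightarrow> i (\<rho> L A) = quot_br br I X (i A)) \<and>
      range i = coset I ` orth_compl ipg I \<and>
      (\<forall>A B. \<forall>x\<in>i A. \<forall>y\<in>i B. ipg x y = ip A B))"

definition quad_exts ::
  "('l::real_vector \<Rightarrow> 'l \<Rightarrow> 'l) \<Rightarrow> ('l \<Rightarrow> 'l) \<Rightarrow> ('a::real_vector \<Rightarrow> 'a \<Rightarrow> real) \<Rightarrow>
   ('l \<Rightarrow> 'a \<Rightarrow> 'a) \<Rightarrow> ('a \<Rightarrow> 'a) \<Rightarrow> ('g::real_vector, 'a, 'l) quad_ext set" where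
  "quad_exts brl \<theta>l ip \<rho> \<theta>a = {E. is_quad_ext brl \<theta>l ip \<rho> \<theta>a E}"

definition ext_equiv ::
  "('g::real_vector, 'a, 'l) quad_ext \<Rightarrow> ('h::real_vector, 'a, 'l) quad_ext \<Rightarrow> bool" where
  "ext_equiv E1 E2 \<longleftrightarrow> (\<exists>\<Psi>. linear \<Psi> \<and> bij \<Psi> \<and>
     (\<forall>x y. \<Psi> (qbr E1 x y) = qbr E2 (\<Psi> x) (\<Psi> y)) \<and>
     (\<forall>x y. qip E2 (\<Psi> x) (\<Psi> y) = qip E1 x y) \<and>
     (\<forall>x. \<Psi> (qinv E1 x) = qinv E2 (\<Psi> x)) \<and>
     \<Psi> ` qideal E1 = qideal E2 \<and>
     (\<forall>A. \<Psi> ` qinj E1 A = qinj E2 A) \<and>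
     (\<forall>X\<in>quot (qideal E1). qproj E2 (\<Psi> ` X) = qproj E1 X))"

definition ext_equiv_rel where
  "ext_equiv_rel brl \<theta>l ip \<rho> \<theta>a =
     {(E1, E2). E1 \<in> quad_exts brl \<theta>l ip \<rho> \<theta>a \<and> E2 \<in> quad_exts brl \<theta>l ip \<rho> \<theta>a \<and> ext_equiv E1 E2}"


section \<open>The dual space\<close>

typedef (overloaded) 'l dual = "{Z :: 'l::real_vector \<Rightarrow> real. linear Z}"
  morphisms dual_app Abs_dual
  by (rule exI[of _ "\<lambda>_. 0"]) (simp add: linear_zero)

setup_lifting type_definition_dual

instantiation dual :: (real_vector) real_vector
begin

lift_definition zero_dual :: "'a dual" is "\<lambda>_. 0"
  by (simp add: linear_zero)

lift_definition plus_dual :: "'a dual \<Rightarrow> 'a dual \<Rightarrow> 'a dual" is "\<lambda>Y Z x. Y x + Z x"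
  by (rule linear_compose_add)

lift_definition minus_dual :: "'a dual \<Rightarrow> 'a dual \<Rightarrow> 'a dual" is "\<lambda>Y Z x. Y x - Z x"
  by (rule linear_compose_sub)

lift_definition uminus_dual :: "'a dual \<Rightarrow> 'a dual" is "\<lambda>Z x. - Z x"
  by (rule linear_compose_neg)

lift_definition scaleR_dual :: "real \<Rightarrow> 'a dual \<Rightarrow> 'a dual" is "\<lambda>c Z x. c * Z x"
  using linear_compose_scale_right by fastforce

instance
  by standard (transfer; simp add: fun_eq_iff algebra_simps)+

end


section \<open>The standard model\<close>

text \<open>
  The bracket below is the bilinear antisymmetric extension of
  \<open>[Z\<^sub>1, Z\<^sub>2] = [Z, A] = 0\<close>,
  \<open>[L\<^sub>1, L\<^sub>2] = \<gamma>(L\<^sub>1, L\<^sub>2, \<sqdot>) + \<alpha>(L\<^sub>1, L\<^sub>2) + [L\<^sub>1, L\<^sub>2]\<^sub>l\<close>,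
  \<open>[L, A] = \<rho>(L) A - \<langle>A, \<alpha>(L, \<sqdot>)\<rangle>\<close>,
  \<open>[L, Z] = - Z([L, \<sqdot>])\<close> and \<open>[A\<^sub>1, A\<^sub>2] = \<langle>\<rho>(\<sqdot>) A\<^sub>1, A\<^sub>2\<rangle>\<close>.
\<close>

definition std_br ::
  "('l::real_vector \<Rightarrow> 'l \<Rightarrow> 'l) \<Rightarrow> ('a::real_vector \<Rightarrow> 'a \<Rightarrow> real) \<Rightarrow> ('l \<Rightarrow> 'a \<Rightarrow> 'a) \<Rightarrow>
   ('l list \<Rightarrow> 'a) \<Rightarrow> ('l list \<Rightarrow> real) \<Rightarrow>
   'l dual \<times> 'a \<times> 'l \<Rightarrow> 'l dual \<times> 'a \<times> 'l \<Rightarrow> 'l dual \<times> 'a \<times> 'l" where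
  "std_br br ip \<rho> \<alpha> \<gamma> = (\<lambda>(Z1, A1, L1) (Z2, A2, L2).
     (Abs_dual (\<lambda>M. \<gamma> [L1, L2, M]
        - ip A2 (\<alpha> [L1, M]) + ip A1 (\<alpha> [L2, M])
        - dual_app Z2 (br L1 M) + dual_app Z1 (br L2 M)
        + ip (\<rho> M A1) A2),
      \<alpha> [L1, L2] + \<rho> L1 A2 - \<rho> L2 A1,
      br L1 L2))"

definition std_ip ::
  "('a \<Rightarrow> 'a \<Rightarrow> real) \<Rightarrow> 'l::real_vector dual \<times> 'a \<times> 'l \<Rightarrow> 'l dual \<times> 'a \<times> 'l \<Rightarrow> real" where
  "std_ip ip = (\<lambda>(Z1, A1, L1) (Z2, A2, L2). ip A1 A2 + dual_app Z1 L2 + dual_app Z2 L1)"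

definition std_inv ::
  "('l::real_vector \<Rightarrow> 'l) \<Rightarrow> ('a \<Rightarrow> 'a) \<Rightarrow> 'l dual \<times> 'a \<times> 'l \<Rightarrow> 'l dual \<times> 'a \<times> 'l" where
  "std_inv \<theta>l \<theta>a = (\<lambda>(Z, A, L). (Abs_dual (\<lambda>M. dual_app Z (\<theta>l M)), \<theta>a A, \<theta>l L))"

definition std_ideal :: "('l::real_vector dual \<times> 'a::real_vector \<times> 'l) set" where
  "std_ideal = {(Z, 0, 0) | Z. True}"

text \<open>
  The coset of \<open>(Z, A, L)\<close> modulo \<^const>\<open>std_ideal\<close> corresponds to \<open>(A, L)\<close>; so \<open>i\<close> sends \<open>A\<close> to the
  coset of \<open>(0, A, 0)\<close> and \<open>p\<close> sends a coset to the common last component of its elements.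
\<close>

definition std_ext ::
  "('l::real_vector \<Rightarrow> 'l \<Rightarrow> 'l) \<Rightarrow> ('l \<Rightarrow> 'l) \<Rightarrow> ('a::real_vector \<Rightarrow> 'a \<Rightarrow> real) \<Rightarrow>
   ('l \<Rightarrow> 'a \<Rightarrow> 'a) \<Rightarrow> ('a \<Rightarrow> 'a) \<Rightarrow> ('l list \<Rightarrow> 'a) \<times> ('l list \<Rightarrow> real) \<Rightarrow>
   ('l dual \<times> 'a \<times> 'l, 'a, 'l) quad_ext" where
  "std_ext br \<theta>l ip \<rho> \<theta>a = (\<lambda>(\<alpha>, \<gamma>).
     \<lparr> qbr = std_br br ip \<rho> \<alpha> \<gamma>,
       qip = std_ip ip,
       qinv = std_inv \<theta>l \<theta>a,
       qideal = std_ideal,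
       qinj = (\<lambda>A. coset std_ideal (0, A, 0)),
       qproj = (\<lambda>X. THE L. \<exists>Z A. (Z, A, L) \<in> X) \<rparr>)"

end

theory Submission
  imports Defs
begin

text \<open>
  A quadratic extension is a metric Lie algebra \<open>g\<close> with an isotropic ideal \<open>I\<close>, and it is built from
  three pieces: \<open>l \<cong> g / I\<^sup>\<bottom>\<close> via the projection \<open>p: g \<rightarrow> l\<close>, \<open>a \<cong> I\<^sup>\<bottom> / I\<close>, and \<open>I\<close> itself.  Since the scalar product of \<open>a\<close> is non-degenerate, \<open>I\<close> is its own
  double orthogonal complement, so pairing with \<open>g\<close> identifies \<open>I\<close> with the dual of \<open>g / I\<^sup>\<bottom> \<cong> l\<close>
  (\<open>dual_represented\<close>).  To compare \<open>g\<close> with the standard model it remains to choose how \<open>l\<close> sits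
  inside \<open>g\<close>.
  
  The proof therefore revolves around adapted sections: linear maps \<open>s: l \<rightarrow> g\<close> that split the
  projection to \<open>l\<close>, commute with the involutions and have isotropic image.  They always exist: take
  any linear splitting, average it over the involution, and subtract half of the \<open>I\<close>-valued map that
  represents the scalar product induced on \<open>l\<close> (\<open>adapted_section_exists\<close>).  The failure of \<open>s\<close> to be
  a homomorphism is measured by \<open>\<alpha>(x, y) = [s x, s y] - s [x, y]\<close> modulo \<open>I\<close> and
  \<open>\<gamma>(x, y, z) = \<langle>[s x, s y], s z\<rangle>\<close>.  The coordinates
  \<open>u \<mapsto> (\<langle>u, s \<cdot>\<rangle>, u - s (p u) mod I, p u)\<close> then turn \<open>g\<close> into the standard model of \<open>(\<alpha>, \<gamma>)\<close>
  (\<open>coord_br\<close>, \<open>ext_equiv_section_cocycle\<close>).  That \<open>(\<alpha>, \<gamma>)\<close> is a quadratic cocycle needs no separate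
  computation: the cocycle equations are equivalent to the Jacobi identity of the model
  (\<open>std_br_jacobi\<close>, \<open>Z2Q_if_jacobi\<close>), which is inherited from \<open>g\<close>.
  
  Conversely, an equivalence from \<open>g\<close> to the standard model of \<open>z\<close> pulls back the obvious section of the
  model to an adapted section of \<open>g\<close> with cocycle \<open>z\<close> (\<open>adapted_section_of_equiv\<close>).  So \<open>g\<close> is equivalent
  to the standard model of \<open>z\<close> if and only if \<open>z\<close> is the cocycle of some adapted section of \<open>g\<close>.
  Apply this to \<open>g\<close> the standard model of a cocycle \<open>z\<close>: its adapted sections are
  \<open>x \<mapsto> (\<sigma>(x, \<cdot>) - 1/2 \<langle>\<tau> x, \<tau> \<cdot>\<rangle>, \<tau> x, x)\<close> with \<open>(\<tau>, \<sigma>)\<close> an invariant quadratic 1-cochain, and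
  the cocycle of this section is exactly \<open>z (\<tau>, \<sigma>)\<close> (\<open>adapted_section_std\<close>,
  \<open>section_cocycle_std_section\<close>).  Hence two cocycles lie in one orbit if and only if their standard
  models are equivalent (\<open>orbit_rel_iff\<close>).  In particular the orbit relation is an equivalence relation
  because equivalence of extensions is one, and the classification follows.
\<close>

section \<open>Cochains, differentials and wedge products in low degree\<close>

lemma list_len1: "length xs = Suc 0 \<longleftrightarrow> (\<exists>x. xs = [x])"
  by (auto simp: length_Suc_conv)
lemma list_len2: "length xs = 2 \<longleftrightarrow> (\<exists>x y. xs = [x,y])"
  by (auto simp: length_Suc_conv numeral_eq_Suc)
lemma list_len3: "length xs = 3 \<longleftrightarrow> (\<exists>x y z. xs = [x,y,z])"
  by (auto simp: length_Suc_conv numeral_eq_Suc)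
lemma list_len4: "length xs = 4 \<longleftrightarrow> (\<exists>x y z w. xs = [x,y,z,w])"
  by (auto simp: length_Suc_conv numeral_eq_Suc)

lemma length_nths_remove1: "i < length xs \<Longrightarrow> length (nths xs (- {i})) = length xs - 1"
proof -
  assume i: "i < length xs"
  have "{k. k < length xs \<and> k \<in> - {i}} = {..<length xs} - {i}" by auto
  then show ?thesis using i by (simp add: length_nths)
qed

lemma length_nths_remove2:
  "i < j \<Longrightarrow> j < length xs \<Longrightarrow> length (nths xs (- {i, j})) = length xs - 2"
proof -
  assume ij: "i < j" "j < length xs"
  have "{k. k < length xs \<and> k \<in> - {i, j}} = {..<length xs} - {i, j}" by auto
  then show ?thesis using ij by (simp add: length_nths card_Diff_subset)
qed

text \<open>
  By this lemma and its analogue for the wedge product, an identity between cochains only has to be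
  checked on lists of the one relevant length.
\<close>

lemma ce_diff_wrong_length:
  assumes "\<And>x. \<rho> x 0 = 0" "\<And>ys. length ys \<noteq> p \<Longrightarrow> f ys = 0" "length xs \<noteq> Suc p"
  shows "ce_diff br \<rho> f xs = 0"
proof -
  have "f (nths xs (- {i})) = 0" if "i < length xs" for i
    using that assms by (intro assms(2)) (simp add: length_nths_remove1)
  moreover have "f (br (xs ! i) (xs ! j) # nths xs (- {i, j})) = 0" if "i < j" "j < length xs" for i j
    using that assms by (intro assms(2)) (simp add: length_nths_remove2)
  ultimately show ?thesis
    using assms(1) by (simp add: ce_diff_def)
qed

lemma ce_diff_2:
  "ce_diff br \<rho> f [x, y] = \<rho> x (f [y]) - \<rho> y (f [x]) - f [br x y]"
  by (simp add: ce_diff_def nths_Cons lessThan_Suc)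

lemma ce_diff_3:
  "ce_diff br \<rho> f [x, y, z] =
     \<rho> x (f [y, z]) - \<rho> y (f [x, z]) + \<rho> z (f [x, y])
     - f [br x y, z] + f [br x z, y] - f [br y z, x]"
  by (simp add: ce_diff_def nths_Cons lessThan_Suc)

lemma ce_diff_4:
  "ce_diff br \<rho> f [x, y, z, w] =
     \<rho> x (f [y, z, w]) - \<rho> y (f [x, z, w]) + \<rho> z (f [x, y, w]) - \<rho> w (f [x, y, z])
     - f [br x y, z, w] + f [br x z, y, w] - f [br x w, y, z]
     - f [br y z, x, w] + f [br y w, x, z] - f [br z w, x, y]"
  by (simp add: ce_diff_def nths_Cons lessThan_Suc)

lemma shuffle_sign_eq:
  assumes "S \<subseteq> {..<n}"
  shows "shuffle_sign n S = (-1) ^ (\<Sum>i<n. \<Sum>j<i. if i \<in> S \<and> j \<notin> S then 1 else 0)"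
proof -
  have "{(i, j). i \<in> S \<and> j \<in> {..<n} - S \<and> j < i} = (SIGMA i:{..<n}. {j\<in>{..<i}. i \<in> S \<and> j \<notin> S})"
    using assms by auto
  then have "card {(i, j). i \<in> S \<and> j \<in> {..<n} - S \<and> j < i}
      = (\<Sum>i<n. card {j\<in>{..<i}. i \<in> S \<and> j \<notin> S})"
    by simp
  also have "\<dots> = (\<Sum>i<n. \<Sum>j<i. if i \<in> S \<and> j \<notin> S then 1 else 0)"
    by (intro sum.cong refl) (simp add: sum.If_cases Int_def)
  finally show ?thesis by (simp add: shuffle_sign_def)
qed

lemma sum_Pow_insert:
  fixes f :: "'b set \<Rightarrow> 'c::comm_monoid_add"
  assumes "finite A" "a \<notin> A"
  shows "sum f (Pow (insert a A)) = sum f (Pow A) + sum (\<lambda>S. f (insert a S)) (Pow A)"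
proof -
  have "Pow A \<inter> insert a ` Pow A = {}" using assms by auto
  moreover have "inj_on (insert a) (Pow A)"
    using assms(2) unfolding inj_on_def by (metis PowD insert_ident subsetD)
  ultimately show ?thesis
    using assms by (simp add: Pow_insert sum.union_disjoint sum.reindex o_def)
qed

lemma wedge_wrong_length:
  assumes "bilinear ip" "\<And>ys. length ys \<noteq> p \<Longrightarrow> \<alpha> ys = 0" "\<And>ys. length ys \<noteq> q \<Longrightarrow> \<tau> ys = 0"
    and "length xs \<noteq> p + q"
  shows "wedge ip \<alpha> \<tau> xs = 0"
proof -
  have "ip (\<alpha> (nths xs S)) (\<tau> (nths xs (- S))) = 0" for S
  proof -
    have "length (nths xs S) + length (nths xs (- S))
        = card ({i. i < length xs \<and> i \<in> S} \<union> {i. i < length xs \<and> i \<in> - S})"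
      unfolding length_nths by (rule card_Un_disjoint[symmetric]) auto
    also have "{i. i < length xs \<and> i \<in> S} \<union> {i. i < length xs \<and> i \<in> - S} = {..<length xs}" by auto
    finally have "length (nths xs S) + length (nths xs (- S)) = length xs" by simp
    then have "length (nths xs S) \<noteq> p \<or> length (nths xs (- S)) \<noteq> q" using assms(4) by auto
    then show ?thesis using assms by (auto simp: bilinear_lzero bilinear_rzero)
  qed
  then show ?thesis by (simp add: wedge_def)
qed

text \<open>
  Written as a product over pairs of positions, the sign of a shuffle of a concrete list is evaluated by
  rewriting.
\<close>

lemma shuffle_sign_prod:
  assumes "S \<subseteq> {..<n}"
  shows "shuffle_sign n S = (\<Prod>i<n. \<Prod>j<i. if i \<in> S \<and> j \<notin> S then -1 else 1)"
  by (simp add: shuffle_sign_eq[OF assms] power_sum if_distrib cong: if_cong)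

lemma wedge_eq_sum:
  "wedge ip \<alpha> \<tau> xs = (\<Sum>S \<in> Pow {..<length xs}.
     (\<Prod>i<length xs. \<Prod>j<i. if i \<in> S \<and> j \<notin> S then -1 else 1) * ip (\<alpha> (nths xs S)) (\<tau> (nths xs (- S))))"
  unfolding wedge_def by (intro sum.cong refl) (simp add: shuffle_sign_prod)

lemma sum_Pow_3:
  fixes f :: "nat set \<Rightarrow> real"
  shows "sum f (Pow {..<3}) = f {} + f {0} + f {1} + f {1,0} + f {2} + f {2,0} + f {2,1} + f {2,1,0}"
proof -
  have "{..<3} = {2, 1, 0 :: nat}" by auto
  then show ?thesis by (simp add: sum_Pow_insert)
qed

lemma sum_Pow_4:
  fixes f :: "nat set \<Rightarrow> real"
  shows "sum f (Pow {..<4}) = sum f (Pow {..<3}) + sum (\<lambda>S. f (insert 3 S)) (Pow {..<3})"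
proof -
  have "{..<4} = insert 3 {..<3 :: nat}" by auto
  then show ?thesis by (simp add: sum_Pow_insert)
qed

lemma wedge_2_1:
  assumes "bilinear ip" "\<And>ys. length ys \<noteq> 2 \<Longrightarrow> \<alpha> ys = 0" 
  shows "wedge ip \<alpha> \<tau> [x, y, z] = ip (\<alpha> [x, y]) (\<tau> [z]) - ip (\<alpha> [x, z]) (\<tau> [y]) + ip (\<alpha> [y, z]) (\<tau> [x])"
proof -
  have z: "ip (\<alpha> ys) t = 0" if "length ys \<noteq> 2" for ys t
    using assms that by (simp add: bilinear_lzero)
  have l: "length [x, y, z] = 3" by simp
  have e: "{..<3} = {0, 1, 2 :: nat}" "{..<2} = {0, 1 :: nat}" "{..<1} = {0 :: nat}" by auto
  show ?thesis
    unfolding wedge_eq_sum l sum_Pow_3 unfolding e by (simp add: z nths_Cons e)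
qed

lemma wedge_2_2:
  assumes "bilinear ip" "\<And>ys. length ys \<noteq> 2 \<Longrightarrow> \<alpha> ys = 0" 
  shows "wedge ip \<alpha> \<tau> [x, y, z, w] =
      ip (\<alpha> [x, y]) (\<tau> [z, w]) - ip (\<alpha> [x, z]) (\<tau> [y, w]) + ip (\<alpha> [x, w]) (\<tau> [y, z])
    + ip (\<alpha> [y, z]) (\<tau> [x, w]) - ip (\<alpha> [y, w]) (\<tau> [x, z]) + ip (\<alpha> [z, w]) (\<tau> [x, y])"
proof -
  have z: "ip (\<alpha> ys) t = 0" if "length ys \<noteq> 2" for ys t
    using assms that by (simp add: bilinear_lzero)
  have l: "length [x, y, z, w] = 4" by simp
  have e: "{..<4} = {0, 1, 2, 3 :: nat}" "{..<3} = {0, 1, 2 :: nat}" "{..<2} = {0, 1 :: nat}" "{..<1} = {0 :: nat}" by auto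
  show ?thesis
    unfolding wedge_eq_sum l sum_Pow_4 sum_Pow_3 unfolding e by (simp add: z nths_Cons e)
qed

lemma cochains_wrong_length: "f \<in> cochains p \<Longrightarrow> length xs \<noteq> p \<Longrightarrow> f xs = 0"
  by (simp add: cochains_def)

lemma cochains_linear:
  "f \<in> cochains p \<Longrightarrow> length xs = p \<Longrightarrow> i < p \<Longrightarrow> linear (\<lambda>x. f (xs[i := x]))"
  unfolding cochains_def by blast

lemma cochains_not_distinct:
  "f \<in> cochains p \<Longrightarrow> \<not> distinct xs \<Longrightarrow> f xs = 0"
  unfolding cochains_def by blast

lemma cochains_1_iff:
  "f \<in> cochains 1 \<longleftrightarrow> (\<forall>xs. length xs \<noteq> 1 \<longrightarrow> f xs = 0) \<and> linear (\<lambda>x. f [x])" (is "?l \<longleftrightarrow> ?r")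
proof
  assume l: ?l
  show ?r using cochains_linear[OF l, of "[0]" 0] cochains_wrong_length[OF l] by simp
next
  assume r: ?r
  show ?l unfolding cochains_def
    using r by (auto simp: list_len1)
qed

lemma cochains_2_iff:
  "f \<in> cochains 2 \<longleftrightarrow> (\<forall>xs. length xs \<noteq> 2 \<longrightarrow> f xs = 0) \<and>
     bilinear (\<lambda>x y. f [x, y]) \<and> (\<forall>x. f [x, x] = 0)" (is "?l \<longleftrightarrow> ?r")
proof
  assume l: ?l
  have "linear (\<lambda>x. f [x, y])" "linear (\<lambda>x. f [y, x])" for y
    using cochains_linear[OF l, of "[0,y]" 0] cochains_linear[OF l, of "[y,0]" 1] by simp_all
  then show ?r using cochains_wrong_length[OF l] cochains_not_distinct[OF l] by (simp add: bilinear_def)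
next
  assume r: ?r
  show ?l unfolding cochains_def
    using r by (auto simp: list_len2 bilinear_def less_2_cases_iff)
qed

lemma cochains_3_iff:
  "f \<in> cochains 3 \<longleftrightarrow> (\<forall>xs. length xs \<noteq> 3 \<longrightarrow> f xs = 0) \<and>
     (\<forall>x y. linear (\<lambda>z. f [x, y, z])) \<and> (\<forall>x z. linear (\<lambda>y. f [x, y, z])) \<and> (\<forall>y z. linear (\<lambda>x. f [x, y, z])) \<and>
     (\<forall>x y. f [x, x, y] = 0 \<and> f [x, y, y] = 0 \<and> f [x, y, x] = 0)" (is "?l \<longleftrightarrow> ?r")
proof
  assume l: ?l
  have "linear (\<lambda>x. f [x, y, z])" "linear (\<lambda>x. f [y, x, z])" "linear (\<lambda>x. f [y, z, x])" for y z
    using cochains_linear[OF l, of "[0,y,z]" 0] cochains_linear[OF l, of "[y,0,z]" 1]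
      cochains_linear[OF l, of "[y,z,0]" 2] by simp_all
  then show ?r using cochains_wrong_length[OF l] cochains_not_distinct[OF l] by simp
next
  assume r: ?r
  have 3: "i < 3 \<longleftrightarrow> i = 0 \<or> i = 1 \<or> i = 2" for i :: nat by auto
  show ?l unfolding cochains_def
    using r by (auto simp: list_len3 3)
qed

section \<open>Finite-dimensional spaces and non-degenerate forms\<close>

lemma fin_dim_obtain_basis:
  assumes "fin_dim TYPE('v::real_vector)"
  obtains B :: "'v::real_vector set" where "finite B" "independent B" "span B = UNIV"
proof -
  obtain S :: "'v set" where S: "finite S" "span S = UNIV"
    using assms by (auto simp: fin_dim_def)
  obtain B where B: "B \<subseteq> S" "independent B" "S \<subseteq> span B"
    by (rule maximal_independent_subset[of S])
  have "span B = UNIV" using span_mono[OF B(3)] S(2) by (auto simp: span_span)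
  then show ?thesis using that B S finite_subset by blast
qed

text \<open>
  A linear left inverse of the injection carries a finite spanning set to a finite spanning set.
\<close>

lemma fin_dim_if_injective:
  fixes f :: "'v::real_vector \<Rightarrow> 'w::real_vector"
  assumes "linear f" "inj f" "fin_dim TYPE('w)"
  shows "fin_dim TYPE('v)"
proof -
  obtain g where g: "linear g" "g \<circ> f = id"
    using linear_injective_left_inverse[OF assms(1,2)] by blast
  obtain B :: "'w set" where B: "finite B" "span B = UNIV"
    using assms(3) by (auto simp: fin_dim_def)
  have "span (g ` B) = g ` UNIV" using linear_span_image[OF g(1), of B] B(2) by simp
  also have "\<dots> = UNIV" using g(2) by (metis comp_apply id_apply surj_def)
  finally show ?thesis using B(1) unfolding fin_dim_def by blast
qed

lemma fin_dim_prod: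
  assumes "fin_dim TYPE('v::real_vector)" "fin_dim TYPE('w::real_vector)"
  shows "fin_dim TYPE('v::real_vector \<times> 'w::real_vector)"
proof -
  obtain B :: "'v set" where B: "finite B" "span B = UNIV"
    using assms(1) by (auto simp: fin_dim_def)
  obtain C :: "'w set" where C: "finite C" "span C = UNIV"
    using assms(2) by (auto simp: fin_dim_def)
  have "linear (\<lambda>v::'v. (v, 0::'w))" "linear (\<lambda>w::'w. (0::'v, w))"
    by (auto intro!: linearI)
  then have *: "span ((\<lambda>v. (v, 0)) ` B) = range (\<lambda>v::'v. (v, 0::'w))"
    "span ((\<lambda>w. (0, w)) ` C) = range (\<lambda>w::'w. (0::'v, w))"
    using B(2) C(2) by (simp_all add: linear_span_image)
  let ?D = "(\<lambda>v::'v. (v, 0::'w)) ` B \<union> (\<lambda>w. (0, w)) ` C"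
  have "(v, 0) \<in> span ?D" for v
    by (rule subsetD[OF span_mono[of "(\<lambda>v::'v. (v, 0::'w)) ` B"]]) (simp_all add: *)
  moreover have "(0, w) \<in> span ?D" for w
    by (rule subsetD[OF span_mono[of "(\<lambda>w::'w. (0::'v, w)) ` C"]]) (simp_all add: *)
  ultimately have "(v, 0) + (0, w) \<in> span ?D" for v w by (rule span_add)
  then have "span ?D = UNIV" by auto
  moreover have "finite ?D" using B(1) C(1) by simp
  ultimately show ?thesis unfolding fin_dim_def by (intro exI[of _ ?D]) simp
qed

lemma linear_functional_eq_on_basis:
  fixes f g :: "'v::real_vector \<Rightarrow> 'w::real_vector"
  assumes "linear f" "linear g" "span B = UNIV" "\<And>b. b \<in> B \<Longrightarrow> f b = g b"
  shows "f = g"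
  using linear_eq_on[OF assms(1,2), of _ B] assms(3,4) by auto

lemma linear_dual_app: "linear (dual_app Z)"
  using dual_app[of Z] by simp

lemma dual_app_Abs: "linear f \<Longrightarrow> dual_app (Abs_dual f) = f"
  by (simp add: Abs_dual_inverse)

lemma dual_eqI: "(\<And>M. dual_app Z M = dual_app W M) \<Longrightarrow> Z = W"
  by (metis dual_app_inverse ext)

text \<open>
  A functional is determined by its values on a basis, so it may be encoded as the vector having these
  values as coordinates.
\<close>

lemma fin_dim_dual:
  assumes "fin_dim TYPE('l::real_vector)"
  shows "fin_dim TYPE('l::real_vector dual)"
proof -
  obtain B :: "'l set" where B: "finite B" "independent B" "span B = UNIV"
    using fin_dim_obtain_basis[OF assms] .
  define f where "f Z = (\<Sum>b\<in>B. dual_app Z b *\<^sub>R b)" for Z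
  have lin: "linear f"
    by (rule linearI) (simp_all add: f_def plus_dual.rep_eq scaleR_dual.rep_eq sum.distrib
        scaleR_add_left scaleR_sum_right)
  moreover have "inj f"
  proof -
    have "Z = 0" if Z: "f Z = 0" for Z
    proof -
      have "dual_app Z b = 0" if "b \<in> B" for b
        using independentD[OF B(2) B(1) order.refl, of "dual_app Z"] Z that by (simp add: f_def)
      then have "dual_app Z = dual_app 0"
        using linear_functional_eq_on_basis[OF linear_dual_app[of Z] linear_dual_app[of 0] B(3)]
        by (simp add: zero_dual.rep_eq)
      then show ?thesis by (simp add: dual_app_inject)
    qed
    then show ?thesis using linear_injective_0[OF lin] by blast
  qed
  ultimately show ?thesis using fin_dim_if_injective assms by blast
qed

context scalar_product
begin

lemmas ip_simps = bilinear_ladd[OF ip_bilinear] bilinear_radd[OF ip_bilinear]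
  bilinear_lsub[OF ip_bilinear] bilinear_rsub[OF ip_bilinear]
  bilinear_lneg[OF ip_bilinear] bilinear_rneg[OF ip_bilinear]
  bilinear_lmul[OF ip_bilinear] bilinear_rmul[OF ip_bilinear]
  bilinear_lzero[OF ip_bilinear] bilinear_rzero[OF ip_bilinear]

lemma linear_ip: "linear (ip x)"
  using ip_bilinear by (simp add: bilinear_def)

lemma ip_eqI: "(\<And>y. ip x y = ip x' y) \<Longrightarrow> x = x'"
  using ip_nondegenerate[of "x - x'"] by (simp add: ip_simps)

text \<open>
  In a basis \<open>B\<close>, the map \<open>x \<mapsto> (\<Sum>b\<in>B. \<langle>x, b\<rangle> b)\<close> is an injective endomorphism by
  non-degeneracy, hence surjective; so the values \<open>\<langle>x, b\<rangle>\<close> can be prescribed.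
\<close>

lemma functional_represented:
  assumes fd: "fin_dim TYPE('v)" and f: "linear f"
  shows "\<exists>x. \<forall>y. ip x y = f y"
proof -
  obtain B :: "'v set" where B: "finite B" "independent B" "span B = UNIV"
    using fin_dim_obtain_basis[OF fd] .
  interpret F: finite_dimensional_vector_space "scaleR :: real \<Rightarrow> 'v \<Rightarrow> 'v" B
    using B by unfold_locales (auto simp: dependent_raw_def span_raw_def)
  define G where "G x = (\<Sum>b\<in>B. ip x b *\<^sub>R b)" for x
  have lin: "linear G"
    by (rule linearI) (simp_all add: G_def ip_simps sum.distrib scaleR_add_left scaleR_sum_right)
  have "inj G"
  proof -
    have "x = 0" if x: "G x = 0" for x
    proof (rule ip_nondegenerate)
      have "ip x b = 0" if "b \<in> B" for b
        using independentD[OF B(2) B(1) order.refl, of "ip x"] x that by (simp add: G_def)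
      then show "ip x y = 0" for y
        using linear_functional_eq_on_basis[OF linear_ip[of x] linear_zero B(3)] by metis
    qed
    then show ?thesis using linear_injective_0[OF lin] by blast
  qed
  then have "surj G"
    using F.linear_inj_imp_surj[of G] lin by (simp add: linear_def)
  then obtain x where x: "G x = (\<Sum>b\<in>B. f b *\<^sub>R b)" by (metis surjD)
  have "ip x b = f b" if "b \<in> B" for b
  proof -
    have "(\<Sum>b\<in>B. (ip x b - f b) *\<^sub>R b) = 0"
      using x by (simp add: G_def scaleR_diff_left sum_subtractf)
    from independentD[OF B(2) B(1) order.refl this that] show ?thesis by simp
  qed
  then show ?thesis
    using linear_functional_eq_on_basis[OF linear_ip f B(3)] by metis
qed

end

section \<open>Cosets and equivalences of extensions\<close>

lemma mem_coset: "y \<in> coset I x \<longleftrightarrow> y - x \<in> I"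
  by (force simp: coset_def)

lemma coset_eq_iff: "subspace I \<Longrightarrow> coset I x = coset I y \<longleftrightarrow> x - y \<in> I"
proof
  assume I: "subspace I" and "coset I x = coset I y"
  then show "x - y \<in> I" using mem_coset[of x I x] mem_coset[of x I y] subspace_0[OF I] by simp
next
  assume I: "subspace I" and d: "x - y \<in> I"
  have "z - x \<in> I \<longleftrightarrow> z - y \<in> I" for z
    using subspace_add[OF I, of "z - x" "x - y"] subspace_diff[OF I, of "z - y" "x - y"] d by auto
  then show "coset I x = coset I y" by (auto simp: mem_coset)
qed

lemma coset_in_quot [simp]: "coset I x \<in> quot I"
  by (simp add: quot_def)

lemma quot_add_coset:
  assumes "subspace I" shows "quot_add (coset I x) (coset I y) = coset I (x + y)"
proof (intro set_eqI iffI)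
  fix z assume "z \<in> quot_add (coset I x) (coset I y)"
  then obtain u v where "z = (x + u) + (y + v)" "u \<in> I" "v \<in> I"
    by (auto simp: quot_add_def coset_def)
  then show "z \<in> coset I (x + y)"
    using subspace_add[OF assms, of u v] by (simp add: mem_coset algebra_simps)
next
  fix z assume z: "z \<in> coset I (x + y)"
  have "z = x + (z - x)" "x \<in> coset I x" "z - x \<in> coset I y"
    using z subspace_0[OF assms] by (auto simp: mem_coset algebra_simps)
  then show "z \<in> quot_add (coset I x) (coset I y)" unfolding quot_add_def by blast
qed

lemma quot_scale_coset:
  assumes "subspace I" shows "quot_scale I c (coset I x) = coset I (c *\<^sub>R x)"
proof (intro set_eqI iffI)
  fix z assume "z \<in> quot_scale I c (coset I x)"
  then obtain u v where "z = c *\<^sub>R (x + u) + v" "u \<in> I" "v \<in> I"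
    by (auto simp: quot_scale_def coset_def)
  then show "z \<in> coset I (c *\<^sub>R x)"
    using subspace_add[OF assms subspace_scale[OF assms, of u c], of v]
    by (simp add: mem_coset algebra_simps)
next
  fix z assume "z \<in> coset I (c *\<^sub>R x)"
  moreover have "x \<in> coset I x" using subspace_0[OF assms] by (simp add: mem_coset)
  moreover have "z = c *\<^sub>R x + (z - c *\<^sub>R x)" by simp
  ultimately show "z \<in> quot_scale I c (coset I x)"
    unfolding quot_scale_def mem_coset by blast
qed

lemma quot_br_coset:
  assumes I: "subspace I" and br: "bilinear br" 
    and ideal: "\<And>x y. y \<in> I \<Longrightarrow> br x y \<in> I" "\<And>x y. x \<in> I \<Longrightarrow> br x y \<in> I"
  shows "quot_br br I (coset I x) (coset I y) = coset I (br x y)"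
proof (intro set_eqI iffI)
  fix z assume "z \<in> quot_br br I (coset I x) (coset I y)"
  then obtain u v w where z: "z = br (x + u) (y + v) + w" and I': "u \<in> I" "v \<in> I" "w \<in> I"
    by (auto simp: quot_br_def coset_def)
  have "z - br x y = br (x + u) v + br u y + w"
    by (simp add: z bilinear_ladd[OF br] bilinear_radd[OF br])
  then show "z \<in> coset I (br x y)"
    using I' ideal subspace_add[OF I] by (simp add: mem_coset)
next
  fix z assume "z \<in> coset I (br x y)"
  moreover have "x \<in> coset I x" "y \<in> coset I y" using subspace_0[OF I] by (simp_all add: mem_coset)
  moreover have "z = br x y + (z - br x y)" by simp
  ultimately show "z \<in> quot_br br I (coset I x) (coset I y)"
    unfolding quot_br_def mem_coset by blast
qed

lemma image_coset:
  assumes "linear f" shows "f ` coset I x = coset (f ` I) (f x)"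
proof -
  have "f ` coset I x = (\<lambda>z. f (x + z)) ` I" by (auto simp: coset_def)
  also have "\<dots> = coset (f ` I) (f x)" by (auto simp: coset_def linear_add[OF assms])
  finally show ?thesis .
qed

lemma ext_equiv_refl: "ext_equiv E E"
  unfolding ext_equiv_def by (rule exI[of _ id]) (simp add: linear_id)

lemma linear_inv:
  assumes "linear f" "bij f" shows "linear (inv f)"
proof (rule linearI)
  have inv: "f (inv f y) = y" "inv f (f x) = x" for x y
    using assms(2) by (simp_all add: bij_is_surj surj_f_inv_f bij_is_inj)
  show "inv f (x + y) = inv f x + inv f y" for x y
    using inv(2)[of "inv f x + inv f y"] by (simp add: linear_add[OF assms(1)] inv(1))
  show "inv f (c *\<^sub>R x) = c *\<^sub>R inv f x" for c x
    using inv(2)[of "c *\<^sub>R inv f x"] by (simp add: linear_scale[OF assms(1)] inv(1))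
qed

lemma ext_equivE:
  assumes "ext_equiv E1 E2"
  obtains \<Psi> where "linear \<Psi>" "bij \<Psi>"
     "\<And>x y. \<Psi> (qbr E1 x y) = qbr E2 (\<Psi> x) (\<Psi> y)"
     "\<And>x y. qip E2 (\<Psi> x) (\<Psi> y) = qip E1 x y"
     "\<And>x. \<Psi> (qinv E1 x) = qinv E2 (\<Psi> x)"
     "\<Psi> ` qideal E1 = qideal E2"
     "\<And>A. \<Psi> ` qinj E1 A = qinj E2 A"
     "\<And>X. X \<in> quot (qideal E1) \<Longrightarrow> qproj E2 (\<Psi> ` X) = qproj E1 X"
  using assms unfolding ext_equiv_def by (elim exE conjE) (rule that; blast)

lemma ext_equiv_sym:
  assumes "ext_equiv E1 E2" shows "ext_equiv E2 E1"
proof -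
  obtain \<Psi> where \<Psi>: "linear \<Psi>" "bij \<Psi>"
     "\<And>x y. \<Psi> (qbr E1 x y) = qbr E2 (\<Psi> x) (\<Psi> y)"
     "\<And>x y. qip E2 (\<Psi> x) (\<Psi> y) = qip E1 x y"
     "\<And>x. \<Psi> (qinv E1 x) = qinv E2 (\<Psi> x)"
     "\<Psi> ` qideal E1 = qideal E2"
     "\<And>A. \<Psi> ` qinj E1 A = qinj E2 A"
     "\<And>X. X \<in> quot (qideal E1) \<Longrightarrow> qproj E2 (\<Psi> ` X) = qproj E1 X"
    by (rule ext_equivE[OF assms]) (rule that; simp)
  define \<Phi> where "\<Phi> = inv \<Psi>"
  have lin: "linear \<Phi>" unfolding \<Phi>_def using \<Psi>(1,2) by (rule linear_inv)
  have inv: "\<Psi> (\<Phi> y) = y" "\<Phi> (\<Psi> x) = x" for x y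
    using \<Psi>(2) by (simp_all add: \<Phi>_def bij_is_surj surj_f_inv_f bij_is_inj)
  have img: "\<Phi> ` \<Psi> ` X = X" "\<Psi> ` \<Phi> ` Y = Y" for X Y
    by (simp_all add: image_image inv)
  have inj: "\<Psi> x = \<Psi> y \<longleftrightarrow> x = y" for x y using inv by metis
  have "bij \<Phi>" using \<Psi>(2) by (simp add: \<Phi>_def bij_imp_bij_inv)
  moreover have "\<Phi> (qbr E2 x y) = qbr E1 (\<Phi> x) (\<Phi> y)" for x y
    by (subst inj[symmetric]) (simp add: inv \<Psi>(3))
  moreover have "qip E1 (\<Phi> x) (\<Phi> y) = qip E2 x y" for x y
    by (simp add: inv \<Psi>(4)[symmetric])
  moreover have "\<Phi> (qinv E2 x) = qinv E1 (\<Phi> x)" for x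
    by (subst inj[symmetric]) (simp add: inv \<Psi>(5))
  moreover have I: "\<Phi> ` qideal E2 = qideal E1"
    using img(1)[of "qideal E1"] \<Psi>(6) by simp
  moreover have "\<Phi> ` qinj E2 A = qinj E1 A" for A
    using img(1)[of "qinj E1 A"] \<Psi>(7) by simp
  moreover have "qproj E1 (\<Phi> ` X) = qproj E2 X" if "X \<in> quot (qideal E2)" for X
  proof -
    have "\<Phi> ` X \<in> quot (qideal E1)"
      using that image_coset[OF lin] I by (auto simp: quot_def)
    from \<Psi>(8)[OF this] show ?thesis by (simp add: img)
  qed
  ultimately show ?thesis using lin unfolding ext_equiv_def by blast
qed

lemma ext_equiv_trans:
  assumes "ext_equiv E1 E2" "ext_equiv E2 E3" shows "ext_equiv E1 E3"
proof -
  obtain \<Psi> where \<Psi>: "linear \<Psi>" "bij \<Psi>"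
     "\<And>x y. \<Psi> (qbr E1 x y) = qbr E2 (\<Psi> x) (\<Psi> y)"
     "\<And>x y. qip E2 (\<Psi> x) (\<Psi> y) = qip E1 x y"
     "\<And>x. \<Psi> (qinv E1 x) = qinv E2 (\<Psi> x)"
     "\<Psi> ` qideal E1 = qideal E2"
     "\<And>A. \<Psi> ` qinj E1 A = qinj E2 A"
     "\<And>X. X \<in> quot (qideal E1) \<Longrightarrow> qproj E2 (\<Psi> ` X) = qproj E1 X"
    by (rule ext_equivE[OF assms(1)]) (rule that; simp)
  obtain \<Phi> where \<Phi>: "linear \<Phi>" "bij \<Phi>"
     "\<And>x y. \<Phi> (qbr E2 x y) = qbr E3 (\<Phi> x) (\<Phi> y)"
     "\<And>x y. qip E3 (\<Phi> x) (\<Phi> y) = qip E2 x y"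
     "\<And>x. \<Phi> (qinv E2 x) = qinv E3 (\<Phi> x)"
     "\<Phi> ` qideal E2 = qideal E3"
     "\<And>A. \<Phi> ` qinj E2 A = qinj E3 A"
     "\<And>X. X \<in> quot (qideal E2) \<Longrightarrow> qproj E3 (\<Phi> ` X) = qproj E2 X"
    by (rule ext_equivE[OF assms(2)]) (rule that; simp)
  define \<Xi> where "\<Xi> = \<Phi> \<circ> \<Psi>"
  have \<Xi>: "\<Xi> x = \<Phi> (\<Psi> x)" "\<Xi> ` X = \<Phi> ` \<Psi> ` X" for x X
    by (auto simp: \<Xi>_def)
  have "linear \<Xi>" "bij \<Xi>"
    unfolding \<Xi>_def using \<Psi>(1,2) \<Phi>(1,2) by (simp_all add: linear_compose bij_comp)
  moreover have "\<Psi> ` X \<in> quot (qideal E2)" if "X \<in> quot (qideal E1)" for X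
    using that image_coset[OF \<Psi>(1)] \<Psi>(6) by (auto simp: quot_def)
  then have "\<forall>X\<in>quot (qideal E1). qproj E3 (\<Xi> ` X) = qproj E1 X"
    unfolding \<Xi> using \<Psi>(8) \<Phi>(8) by metis
  ultimately show ?thesis
    unfolding ext_equiv_def
    by (intro exI[of _ \<Xi>]) (simp only: \<Xi> \<Psi>(3-7) \<Phi>(3-7) simp_thms)
qed

section \<open>The standard model\<close>

context lie_algebra
begin

lemmas br_simps = bilinear_ladd[OF br_bilinear] bilinear_radd[OF br_bilinear]
  bilinear_lsub[OF br_bilinear] bilinear_rsub[OF br_bilinear]
  bilinear_lneg[OF br_bilinear] bilinear_rneg[OF br_bilinear]
  bilinear_lmul[OF br_bilinear] bilinear_rmul[OF br_bilinear]
  bilinear_lzero[OF br_bilinear] bilinear_rzero[OF br_bilinear]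

lemma br_swap: "br y x = - br x y"
  using br_alternating[of "x + y"] br_alternating[of x] br_alternating[of y]
  by (simp add: br_simps eq_neg_iff_add_eq_0 ac_simps)

end

lemmas dual_simps = zero_dual.rep_eq plus_dual.rep_eq minus_dual.rep_eq uminus_dual.rep_eq
  scaleR_dual.rep_eq linear_add[OF linear_dual_app] linear_diff[OF linear_dual_app]
  linear_neg[OF linear_dual_app] linear_scale[OF linear_dual_app] linear_0[OF linear_dual_app]

context orthogonal_module
begin

lemmas rep_simps = bilinear_ladd[OF rep_bilinear] bilinear_radd[OF rep_bilinear]
  bilinear_lsub[OF rep_bilinear] bilinear_rsub[OF rep_bilinear]
  bilinear_lneg[OF rep_bilinear] bilinear_rneg[OF rep_bilinear]
  bilinear_lmul[OF rep_bilinear] bilinear_rmul[OF rep_bilinear]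
  bilinear_lzero[OF rep_bilinear] bilinear_rzero[OF rep_bilinear]

lemmas mod_inv_simps = linear_add[OF mod_inv_linear] linear_diff[OF mod_inv_linear]
  linear_neg[OF mod_inv_linear] linear_scale[OF mod_inv_linear] linear_0[OF mod_inv_linear]
  linear_add[OF L.inv_linear] linear_diff[OF L.inv_linear]
  linear_neg[OF L.inv_linear] linear_scale[OF L.inv_linear] linear_0[OF L.inv_linear]

lemma rep_skew_self: "ip u (\<rho> x u) = 0"
  using rep_skew[of x u u] A.ip_sym[of "\<rho> x u" u] by simp

lemma rep_skew_twice: "ip u (\<rho> x (\<rho> y v)) = ip v (\<rho> y (\<rho> x u))"
  using rep_skew[of x u "\<rho> y v"] rep_skew[of y v "\<rho> x u"]
    A.ip_sym[of "\<rho> x u" "\<rho> y v"] by simp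

lemmas linearity_simps = L.br_simps A.ip_simps rep_simps dual_simps mod_inv_simps

end

lemma triple_eqI:
  fixes x y :: "'l::real_vector dual \<times> 'a \<times> 'l"
  assumes "\<And>M. dual_app (fst x) M = dual_app (fst y) M" "fst (snd x) = fst (snd y)"
    "snd (snd x) = snd (snd y)"
  shows "x = y"
  using assms by (simp add: prod_eq_iff dual_eqI)

text \<open>
  The data of a standard model before any cocycle equation is imposed.  All algebraic properties of the
  model other than the Jacobi identity hold at this level.
\<close>

locale invariant_cochains = orthogonal_module brl \<theta>l ip \<rho> \<theta>a
  for brl :: "'l::real_vector \<Rightarrow> 'l \<Rightarrow> 'l"
    and \<theta>l :: "'l \<Rightarrow> 'l"
    and ip :: "'a::real_vector \<Rightarrow> 'a \<Rightarrow> real"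
    and \<rho> :: "'l \<Rightarrow> 'a \<Rightarrow> 'a"
    and \<theta>a :: "'a \<Rightarrow> 'a" +
  fixes \<alpha> :: "'l list \<Rightarrow> 'a" and \<gamma> :: "'l list \<Rightarrow> real"
  assumes alpha: "\<alpha> \<in> cochains_plus \<theta>l \<theta>a 2"
    and gamma: "\<gamma> \<in> cochains_plus \<theta>l id 3"
begin

lemma alpha_cochain: "\<alpha> \<in> cochains 2" and gamma_cochain: "\<gamma> \<in> cochains 3"
  using alpha gamma by (simp_all add: cochains_plus_def)

lemma alpha_bilinear: "bilinear (\<lambda>x y. \<alpha> [x, y])"
  using alpha_cochain by (simp add: cochains_2_iff)

lemmas alpha_simps = bilinear_ladd[OF alpha_bilinear] bilinear_radd[OF alpha_bilinear]
  bilinear_lsub[OF alpha_bilinear] bilinear_rsub[OF alpha_bilinear]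
  bilinear_lneg[OF alpha_bilinear] bilinear_rneg[OF alpha_bilinear]
  bilinear_lmul[OF alpha_bilinear] bilinear_rmul[OF alpha_bilinear]
  bilinear_lzero[OF alpha_bilinear] bilinear_rzero[OF alpha_bilinear]

lemma alpha_same: "\<alpha> [x, x] = 0"
  using alpha_cochain by (simp add: cochains_2_iff)

lemma alpha_swap: "\<alpha> [y, x] = - \<alpha> [x, y]"
  using alpha_same[of "x + y"] alpha_same[of x] alpha_same[of y]
  by (simp add: alpha_simps eq_neg_iff_add_eq_0 ac_simps)

lemma gamma_linear:
  "linear (\<lambda>z. \<gamma> [x, y, z])" "linear (\<lambda>y. \<gamma> [x, y, z])" "linear (\<lambda>x. \<gamma> [x, y, z])"
  using gamma_cochain by (simp_all add: cochains_3_iff)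

lemmas gamma_simps = 
  gamma_linear(1)[THEN linear_add] gamma_linear(2)[THEN linear_add] gamma_linear(3)[THEN linear_add]
  gamma_linear(1)[THEN linear_diff] gamma_linear(2)[THEN linear_diff] gamma_linear(3)[THEN linear_diff]
  gamma_linear(1)[THEN linear_neg] gamma_linear(2)[THEN linear_neg] gamma_linear(3)[THEN linear_neg]
  gamma_linear(1)[THEN linear_scale] gamma_linear(2)[THEN linear_scale] gamma_linear(3)[THEN linear_scale]
  gamma_linear(1)[THEN linear_0] gamma_linear(2)[THEN linear_0] gamma_linear(3)[THEN linear_0]

lemma gamma_same: "\<gamma> [x, x, y] = 0" "\<gamma> [x, y, y] = 0" "\<gamma> [x, y, x] = 0"
  using gamma_cochain by (simp_all add: cochains_3_iff)

lemma gamma_swap: "\<gamma> [y, x, z] = - \<gamma> [x, y, z]" "\<gamma> [x, z, y] = - \<gamma> [x, y, z]"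
  using gamma_same(1)[of "x + y" z] gamma_same(1)[of x z] gamma_same(1)[of y z]
    gamma_same(2)[of x "y + z"] gamma_same(2)[of x y] gamma_same(2)[of x z]
  by (simp_all add: gamma_simps)

lemma alpha_inv: "\<alpha> [\<theta>l x, \<theta>l y] = \<theta>a (\<alpha> [x, y])"
proof -
  have "cochain_inv \<theta>l \<theta>a \<alpha> [x, y] = \<alpha> [x, y]" using alpha by (simp add: cochains_plus_def)
  then show ?thesis unfolding cochain_inv_def by (metis mod_inv_inv list.map)
qed

lemma gamma_inv: "\<gamma> [\<theta>l x, \<theta>l y, \<theta>l z] = \<gamma> [x, y, z]"
proof -
  have "cochain_inv \<theta>l id \<gamma> [x, y, z] = \<gamma> [x, y, z]" using gamma by (simp add: cochains_plus_def)
  then show ?thesis by (simp add: cochain_inv_def)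
qed

abbreviation "sbr \<equiv> std_br brl ip \<rho> \<alpha> \<gamma>"

lemma std_br_dual:
  "dual_app (fst (sbr (Z1, A1, L1) (Z2, A2, L2))) M =
     \<gamma> [L1, L2, M] - ip A2 (\<alpha> [L1, M]) + ip A1 (\<alpha> [L2, M])
     - dual_app Z2 (brl L1 M) + dual_app Z1 (brl L2 M) + ip (\<rho> M A1) A2"
proof -
  have "linear (\<lambda>M. \<gamma> [L1, L2, M] - ip A2 (\<alpha> [L1, M]) + ip A1 (\<alpha> [L2, M])
     - dual_app Z2 (brl L1 M) + dual_app Z1 (brl L2 M) + ip (\<rho> M A1) A2)"
    by (rule linearI) (simp_all add: linearity_simps alpha_simps gamma_simps algebra_simps)
  then show ?thesis by (simp add: std_br_def dual_app_Abs)
qed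

lemma std_br_snd:
  "fst (snd (sbr (Z1, A1, L1) (Z2, A2, L2))) = \<alpha> [L1, L2] + \<rho> L1 A2 - \<rho> L2 A1"
  "snd (snd (sbr (Z1, A1, L1) (Z2, A2, L2))) = brl L1 L2"
  by (simp_all add: std_br_def)

lemmas std_br_comp = std_br_dual std_br_snd

text \<open>
  The same formulas in terms of projections, so that they apply to nested brackets.
\<close>

lemma std_br_dual':
  "dual_app (fst (sbr x y)) M =
     \<gamma> [snd (snd x), snd (snd y), M] - ip (fst (snd y)) (\<alpha> [snd (snd x), M])
     + ip (fst (snd x)) (\<alpha> [snd (snd y), M])
     - dual_app (fst y) (brl (snd (snd x)) M) + dual_app (fst x) (brl (snd (snd y)) M)
     + ip (\<rho> M (fst (snd x))) (fst (snd y))"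
  using std_br_dual[of "fst x" "fst (snd x)" "snd (snd x)" "fst y" "fst (snd y)" "snd (snd y)" M]
  by simp

lemma std_br_snd':
  "fst (snd (sbr x y)) = \<alpha> [snd (snd x), snd (snd y)] + \<rho> (snd (snd x)) (fst (snd y)) - \<rho> (snd (snd y)) (fst (snd x))"
  "snd (snd (sbr x y)) = brl (snd (snd x)) (snd (snd y))"
  by (simp_all add: std_br_def case_prod_beta)

lemmas std_br_comp' = std_br_dual' std_br_snd'

lemma std_br_bilinear: "bilinear sbr"
  unfolding bilinear_def
  by (intro conjI allI linearI; rule triple_eqI)
    (simp_all add: std_br_comp' linearity_simps alpha_simps gamma_simps algebra_simps)

lemma std_br_alternating: "sbr x x = 0"
  by (rule triple_eqI)
    (simp_all add: std_br_comp' linearity_simps alpha_same gamma_same L.br_alternating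
       rep_skew rep_skew_self)

text \<open>
  The component in \<open>l\<close> is the Jacobi identity of \<open>l\<close>, and the component in \<open>a\<close> is \<open>d \<alpha> = 0\<close> together
  with the representation property.  The component in the dual space, evaluated at \<open>M\<close>, splits by
  type: terms with a functional \<open>Z\<close> cancel by the Jacobi identity of \<open>l\<close>, terms with one \<open>A\<close> because
  they form \<open>\<langle>A, d \<alpha>\<rangle>\<close>, terms with two because \<open>\<rho>\<close> is a skew representation, and what is left is
  \<open>d \<gamma> - 1/2 \<langle>\<alpha> \<and> \<alpha>\<rangle>\<close> at \<open>(L\<^sub>1, L\<^sub>2, L\<^sub>3, M)\<close>.
\<close>

lemma std_br_jacobi:
  assumes dalpha: "\<And>x y z. ce_diff brl \<rho> \<alpha> [x, y, z] = 0"
    and dgamma: "\<And>x y z w. ce_diff_triv brl \<gamma> [x, y, z, w] = 1/2 * wedge ip \<alpha> \<alpha> [x, y, z, w]"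
  shows "sbr x (sbr y z) + sbr y (sbr z x) + sbr z (sbr x y) = 0"
proof -
  obtain Z1 A1 L1 where x: "x = (Z1, A1, L1)" by (cases x) auto
  obtain Z2 A2 L2 where y: "y = (Z2, A2, L2)" by (cases y) auto
  obtain Z3 A3 L3 where z: "z = (Z3, A3, L3)" by (cases z) auto
  have da: "\<rho> x (\<alpha> [y, z]) - \<rho> y (\<alpha> [x, z]) + \<rho> z (\<alpha> [x, y])
     - \<alpha> [brl x y, z] + \<alpha> [brl x z, y] - \<alpha> [brl y z, x] = 0" for x y z
    using dalpha[of x y z] by (simp add: ce_diff_3)
  have dg: "- \<gamma> [brl x y, z, w] + \<gamma> [brl x z, y, w] - \<gamma> [brl x w, y, z]
     - \<gamma> [brl y z, x, w] + \<gamma> [brl y w, x, z] - \<gamma> [brl z w, x, y]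
     = ip (\<alpha> [x, y]) (\<alpha> [z, w]) - ip (\<alpha> [x, z]) (\<alpha> [y, w]) + ip (\<alpha> [x, w]) (\<alpha> [y, z])" for x y z w
    using dgamma[of x y z w] A.ip_sym[of "\<alpha> [z, w]"] A.ip_sym[of "\<alpha> [y, z]"] A.ip_sym[of "\<alpha> [y, w]"]
    by (simp add: ce_diff_4 wedge_2_2[OF A.ip_bilinear cochains_wrong_length[OF alpha_cochain]])
  let ?J = "sbr x (sbr y z) + sbr y (sbr z x) + sbr z (sbr x y)"
  have "snd (snd ?J) = 0"
    using L.br_jacobi by (simp add: x y z std_br_comp')
  moreover have "fst (snd ?J) = 0"
    using da[of L1 L2 L3]
    by (simp add: x y z std_br_comp' linearity_simps alpha_simps rep_br L.br_swap[of L3 L1]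
       alpha_swap[of L3 L1] alpha_swap[of "brl _ _"] algebra_simps)
  moreover have "dual_app (fst ?J) M = 0" for M
  proof -
    have Zj: "dual_app Z (brl a (brl b M)) = dual_app Z (brl (brl a b) M) + dual_app Z (brl b (brl a M))" for Z a b
      using arg_cong[OF L.br_jacobi[of a b M], of "dual_app Z"] L.br_swap[of "brl a b" M] L.br_swap[of a M]
      by (simp add: linearity_simps)
    \<comment> \<open>Instances of the antisymmetry rules that rewrite every term to one normal form: indices
      ascending with \<open>M\<close> last, brackets last in \<open>\<alpha>\<close> and first in \<open>\<gamma>\<close>, and \<open>\<rho>\<close> moved to the
      right argument of the scalar product.  The unrestricted rules would loop.\<close>
    note rules =
       L.br_swap[of L3 L1] L.br_swap[of L2 L1] L.br_swap[of L3 L2] L.br_swap[of M]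
       alpha_swap[of L3 L1] alpha_swap[of L2 L1] alpha_swap[of L3 L2] alpha_swap[of "brl _ _"]
       alpha_swap[of M L1] alpha_swap[of M L2] alpha_swap[of M L3]
       gamma_swap(1)[where x = "brl _ _"] gamma_swap(2)[where y = "brl _ _"]
       gamma_swap(2)[where z = L3 and y = L1] gamma_swap(2)[where z = L2 and y = L1]
       gamma_swap(2)[where z = L3 and y = L2] gamma_swap(2)[where z = M and y = L1]
       gamma_swap(2)[where z = M and y = L2] gamma_swap(2)[where z = M and y = L3]
       rep_skew_twice[of A2 _ _ A1] rep_skew_twice[of A3 _ _ A1] rep_skew_twice[of A3 _ _ A2]
       A.ip_sym[of "\<alpha> [L2, L3]" "\<alpha> _"] A.ip_sym[of "\<alpha> _" A1] A.ip_sym[of "\<alpha> _" A2]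
       A.ip_sym[of "\<alpha> _" A3] A.ip_sym[of "\<alpha> _" "\<rho> _ _"]
    have a1: "ip A (\<rho> x (\<alpha> [y, M]) - \<rho> y (\<alpha> [x, M]) + \<rho> M (\<alpha> [x, y])
     - \<alpha> [brl x y, M] + \<alpha> [brl x M, y] - \<alpha> [brl y M, x]) = 0" for A x y
      by (simp only: da A.ip_simps)
    show ?thesis
      using a1[of A1 L2 L3] a1[of A2 L1 L3] a1[of A3 L1 L2] dg[of L1 L2 L3 M]
        Zj[of Z1 L2 L3] Zj[of Z2 L1 L3] Zj[of Z3 L1 L2]
      by (simp add: x y z std_br_comp' linearity_simps alpha_simps gamma_simps rep_br rep_skew rules)
  qed
  ultimately show ?thesis by (intro triple_eqI) (simp_all add: dual_simps)
qed

text \<open>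
  This trilinear form changes sign when its last two arguments are exchanged, which is the
  ad-invariance of the scalar product.
\<close>

lemma std_ip_br:
  "std_ip ip (sbr (Z1, A1, L1) (Z2, A2, L2)) (Z3, A3, L3) =
     \<gamma> [L1, L2, L3] + ip A3 (\<alpha> [L1, L2]) - ip A2 (\<alpha> [L1, L3]) + ip A1 (\<alpha> [L2, L3])
     + dual_app Z1 (brl L2 L3) - dual_app Z2 (brl L1 L3) + dual_app Z3 (brl L1 L2)
     + ip A3 (\<rho> L1 A2) - ip A3 (\<rho> L2 A1) + ip A2 (\<rho> L3 A1)"
proof -
  have "std_ip ip (sbr (Z1, A1, L1) (Z2, A2, L2)) (Z3, A3, L3) =
    ip A3 (fst (snd (sbr (Z1, A1, L1) (Z2, A2, L2)))) +
    dual_app (fst (sbr (Z1, A1, L1) (Z2, A2, L2))) L3 + dual_app Z3 (snd (snd (sbr (Z1, A1, L1) (Z2, A2, L2))))"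
    by (simp add: std_ip_def case_prod_beta A.ip_sym)
  then show ?thesis
    by (simp add: std_br_comp linearity_simps A.ip_sym[of "\<rho> _ _" A2])
qed

lemma std_br_invariant: "std_ip ip (sbr x y) z + std_ip ip y (sbr x z) = 0"
proof -
  obtain Z1 A1 L1 where x: "x = (Z1, A1, L1)" by (cases x) auto
  obtain Z2 A2 L2 where y: "y = (Z2, A2, L2)" by (cases y) auto
  obtain Z3 A3 L3 where z: "z = (Z3, A3, L3)" by (cases z) auto
  have "std_ip ip y (sbr x z) = std_ip ip (sbr x z) y"
    by (simp add: std_ip_def case_prod_beta A.ip_sym)
  then show ?thesis
    using rep_skew[of L1 A2 A3] A.ip_sym[of "\<rho> L1 A2" A3]
    by (simp add: x y z std_ip_br L.br_swap[of L3 L2] alpha_swap[of L3 L2] gamma_swap(2)[where z = L3 and y = L2] linearity_simps)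
qed

end

lemma linear_functional_nonzero:
  fixes v :: "'v::real_vector"
  assumes "v \<noteq> 0"
  obtains f :: "'v \<Rightarrow> real" where "linear f" "f v \<noteq> 0"
proof -
  have "independent {v}" using independent_insertI[of v "{}"] assms by simp
  then obtain f :: "'v \<Rightarrow> real" where "linear f" "\<forall>x\<in>{v}. f x = 1"
    using linear_independent_extend[of "{v}" "\<lambda>_. 1"] by blast
  then show ?thesis using that[of f] by simp
qed

context orthogonal_module
begin

lemma dual_inv_app: "dual_app (Abs_dual (\<lambda>M. dual_app Z (\<theta>l M))) M = dual_app Z (\<theta>l M)"
proof -
  have "linear (\<lambda>M. dual_app Z (\<theta>l M))"
    using linear_compose[OF L.inv_linear linear_dual_app[of Z]] by (simp add: o_def)
  then show ?thesis by (simp add: dual_app_Abs)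
qed

lemma std_inv_comp:
  "dual_app (fst (std_inv \<theta>l \<theta>a x)) M = dual_app (fst x) (\<theta>l M)"
  "fst (snd (std_inv \<theta>l \<theta>a x)) = \<theta>a (fst (snd x))"
  "snd (snd (std_inv \<theta>l \<theta>a x)) = \<theta>l (snd (snd x))"
  by (simp_all add: std_inv_def case_prod_beta dual_inv_app)

lemma std_ip_comp:
  "std_ip ip x y = ip (fst (snd x)) (fst (snd y)) + dual_app (fst x) (snd (snd y)) + dual_app (fst y) (snd (snd x))"
  by (simp add: std_ip_def case_prod_beta)

lemma std_ip_scalar_product: "scalar_product (std_ip ip :: 'l dual \<times> 'a \<times> 'l \<Rightarrow> _)"
proof
  show "bilinear (std_ip ip :: 'l dual \<times> 'a \<times> 'l \<Rightarrow> _)"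
    unfolding bilinear_def
    by (intro conjI allI linearI) (simp_all add: std_ip_comp linearity_simps algebra_simps)
  show "std_ip ip x y = std_ip ip y x" for x y :: "'l dual \<times> 'a \<times> 'l"
    by (simp add: std_ip_comp A.ip_sym)
next
  fix x :: "'l dual \<times> 'a \<times> 'l" assume 0: "\<And>y. std_ip ip x y = 0"
  have "dual_app (fst x) M = 0" for M
    using 0[of "(0, 0, M)"] by (simp add: std_ip_comp linearity_simps)
  moreover have "fst (snd x) = 0"
    using 0[of "(0, _, 0)"] by (intro A.ip_nondegenerate) (simp add: std_ip_comp linearity_simps)
  moreover have "snd (snd x) = 0"
  proof (rule ccontr)
    assume "snd (snd x) \<noteq> 0"
    then obtain f :: "'l \<Rightarrow> real" where f: "linear f" "f (snd (snd x)) \<noteq> 0"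
      by (metis linear_functional_nonzero)
    show False
      using 0[of "(Abs_dual f, 0, 0)"] f by (simp add: std_ip_comp linearity_simps dual_app_Abs)
  qed
  ultimately show "x = 0" by (intro triple_eqI) (simp_all add: dual_simps)
qed

lemma Z2Q_iff:
  "(\<alpha>, \<gamma>) \<in> Z2Q brl \<theta>l ip \<rho> \<theta>a \<longleftrightarrow>
     invariant_cochains brl \<theta>l ip \<rho> \<theta>a \<alpha> \<gamma> \<and>
     (\<forall>x y z. ce_diff brl \<rho> \<alpha> [x, y, z] = 0) \<and>
     (\<forall>x y z w. ce_diff_triv brl \<gamma> [x, y, z, w] = 1/2 * wedge ip \<alpha> \<alpha> [x, y, z, w])"
  (is "?l \<longleftrightarrow> ?r")
proof
  assume ?l
  then show ?r
    by (auto simp: Z2Q_def invariant_cochains_def invariant_cochains_axioms_def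
        orthogonal_module_axioms)
next
  assume r: ?r
  then interpret invariant_cochains brl \<theta>l ip \<rho> \<theta>a \<alpha> \<gamma> by simp
  have "ce_diff brl \<rho> \<alpha> xs = 0" for xs
  proof (cases "length xs = 3")
    case True then show ?thesis using r by (auto simp: list_len3)
  next
    case False
    then show ?thesis
      by (intro ce_diff_wrong_length[of _ 2] cochains_wrong_length[OF alpha_cochain])
        (simp_all add: rep_simps)
  qed
  moreover have "ce_diff_triv brl \<gamma> xs = 1/2 * wedge ip \<alpha> \<alpha> xs" for xs
  proof (cases "length xs = 4")
    case True then show ?thesis using r by (auto simp: list_len4)
  next
    case False
    have "ce_diff_triv brl \<gamma> xs = 0"
      using False by (intro ce_diff_wrong_length[of _ 3] cochains_wrong_length[OF gamma_cochain]) simp_all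
    moreover have "wedge ip \<alpha> \<alpha> xs = 0"
      using False by (intro wedge_wrong_length[of _ 2 _ 2] A.ip_bilinear
          cochains_wrong_length[OF alpha_cochain]) simp_all
    ultimately show ?thesis by simp
  qed
  ultimately show ?l
    using alpha gamma by (auto simp: Z2Q_def)
qed

end

context invariant_cochains
begin

text \<open>
  Rules that move an involution across an operation; they turn the invariance conditions, which apply
  the involution to all arguments at once, into rewrite rules for a single argument.
\<close>

lemma alpha_inv_shift: "\<alpha> [\<theta>l x, y] = \<theta>a (\<alpha> [x, \<theta>l y])"
  using alpha_inv[of x "\<theta>l y"] by (simp add: L.inv_inv)

lemma gamma_inv_shift: "\<gamma> [\<theta>l x, \<theta>l y, z] = \<gamma> [x, y, \<theta>l z]"
  using gamma_inv[of x y "\<theta>l z"] by (simp add: L.inv_inv)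

lemma br_inv_shift: "brl (\<theta>l x) y = \<theta>l (brl x (\<theta>l y))"
  by (simp add: L.inv_br L.inv_inv)

lemma ip_inv_shift: "ip (\<theta>a u) v = ip u (\<theta>a v)"
  using mod_inv_isometry[of u "\<theta>a v"] by (simp add: mod_inv_inv)

lemma rep_inv: "\<rho> (\<theta>l x) (\<theta>a u) = \<theta>a (\<rho> x u)"
  by (metis mod_inv_inv mod_inv_rep)

lemma std_br_inv: "std_inv \<theta>l \<theta>a (sbr x y) = sbr (std_inv \<theta>l \<theta>a x) (std_inv \<theta>l \<theta>a y)"
proof (rule triple_eqI, goal_cases)
  case (1 M)
  have "\<theta>l (brl z (\<theta>l M)) = brl (\<theta>l z) M" for z by (simp add: br_inv_shift)
  then show ?case
    by (simp add: std_inv_comp std_br_comp' gamma_inv_shift alpha_inv_shift ip_inv_shift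
        mod_inv_inv rep_inv[of _ "\<theta>a _", simplified mod_inv_inv, symmetric]
        mod_inv_rep[symmetric] L.inv_br L.inv_inv)
next
  case 2
  show ?case by (simp add: std_inv_comp std_br_comp' alpha_inv rep_inv mod_inv_simps)
next
  case 3
  show ?case by (simp add: std_inv_comp std_br_comp' L.inv_br)
qed

lemma std_metric_lie_algebra:
  assumes "(\<alpha>, \<gamma>) \<in> Z2Q brl \<theta>l ip \<rho> \<theta>a"
  shows "metric_lie_algebra_inv sbr (std_ip ip) (std_inv \<theta>l \<theta>a)"
proof -
  have "lie_algebra sbr"
  proof
    show "fin_dim TYPE('l dual \<times> 'a \<times> 'l)"
      by (intro fin_dim_prod fin_dim_dual mod_fin_dim L.lie_fin_dim)
    show "bilinear sbr" by (rule std_br_bilinear)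
    show "sbr x x = 0" for x by (rule std_br_alternating)
    show "sbr x (sbr y z) + sbr y (sbr z x) + sbr z (sbr x y) = 0" for x y z
      using assms Z2Q_iff[of \<alpha> \<gamma>] by (intro std_br_jacobi) simp_all
  qed
  moreover have "linear (std_inv \<theta>l \<theta>a :: 'l dual \<times> 'a \<times> 'l \<Rightarrow> _)"
    by (intro linearI triple_eqI) (simp_all add: std_inv_comp linearity_simps)
  moreover have "std_inv \<theta>l \<theta>a (std_inv \<theta>l \<theta>a x) = x" for x :: "'l dual \<times> 'a \<times> 'l"
    by (rule triple_eqI) (simp_all add: std_inv_comp L.inv_inv mod_inv_inv)
  moreover have "std_ip ip (std_inv \<theta>l \<theta>a x) (std_inv \<theta>l \<theta>a y) = std_ip ip x y"
    for x y :: "'l dual \<times> 'a \<times> 'l"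
    by (simp add: std_ip_comp std_inv_comp mod_inv_isometry L.inv_inv)
  ultimately show ?thesis
    unfolding metric_lie_algebra_inv_def metric_lie_algebra_inv_axioms_def
      lie_algebra_inv_def lie_algebra_inv_axioms_def
    using std_br_inv std_br_invariant std_ip_scalar_product by blast
qed

end

context invariant_cochains
begin

text \<open>
  On elements of \<open>l\<close> the components of the Jacobi identity are the cocycle equations themselves.  Thus
  the cocycle equations can be transported along any isomorphism onto the bracket of the model instead
  of being verified directly.
\<close>

lemma Z2Q_if_jacobi:
  assumes "\<And>x y z. sbr x (sbr y z) + sbr y (sbr z x) + sbr z (sbr x y) = 0"
  shows "(\<alpha>, \<gamma>) \<in> Z2Q brl \<theta>l ip \<rho> \<theta>a"
proof -
  have J: "sbr (0, 0, x) (sbr (0, 0, y) (0, 0, z)) + sbr (0, 0, y) (sbr (0, 0, z) (0, 0, x))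
      + sbr (0, 0, z) (sbr (0, 0, x) (0, 0, y)) = 0" for x y z
    by (rule assms)
  have "ce_diff brl \<rho> \<alpha> [x, y, z] = 0" for x y z
    using arg_cong[OF J[of x y z], of "\<lambda>u. fst (snd u)"]
    by (simp add: ce_diff_3 std_br_comp' linearity_simps alpha_simps L.br_swap[of z x]
        alpha_swap[of z x] alpha_swap[of "brl _ _"] algebra_simps)
  moreover have "ce_diff_triv brl \<gamma> [x, y, z, w] = 1/2 * wedge ip \<alpha> \<alpha> [x, y, z, w]" for x y z w
    using arg_cong[OF J[of x y z], of "\<lambda>u. dual_app (fst u) w"]
      A.ip_sym[of "\<alpha> [z, w]"] A.ip_sym[of "\<alpha> [y, z]"] A.ip_sym[of "\<alpha> [y, w]"]
    by (simp add: ce_diff_4 wedge_2_2[OF A.ip_bilinear cochains_wrong_length[OF alpha_cochain]]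
        std_br_comp' linearity_simps alpha_simps gamma_simps alpha_swap[of z x] L.br_swap[of z x]
        gamma_swap(1)[where x = "brl _ _"] gamma_swap(2)[where y = "brl _ _"]
        gamma_swap(2)[where z = z and y = x] gamma_swap(2)[where z = w and y = x]
        gamma_swap(2)[where z = w and y = y] gamma_swap(2)[where z = w and y = z]
        gamma_swap(2)[where z = y and y = x] gamma_swap(2)[where z = z and y = y])
  ultimately show ?thesis
    by (simp add: Z2Q_iff invariant_cochains_axioms)
qed

end

lemma mem_std_ideal: "x \<in> std_ideal \<longleftrightarrow> snd x = 0"
  by (cases x) (auto simp: std_ideal_def zero_prod_def)

lemma subspace_std_ideal: "subspace std_ideal"
  by (simp add: subspace_def mem_std_ideal)

lemma mem_coset_std_ideal: "y \<in> coset std_ideal x \<longleftrightarrow> snd y = snd x"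
  by (simp add: mem_coset mem_std_ideal)

lemma coset_std_ideal_eq_iff: "coset std_ideal x = coset std_ideal y \<longleftrightarrow> snd x = snd y"
  unfolding coset_eq_iff[OF subspace_std_ideal] by (simp add: mem_std_ideal)

lemma std_ext_sel:
  "qbr (std_ext br \<theta>l ip \<rho> \<theta>a (\<alpha>, \<gamma>)) = std_br br ip \<rho> \<alpha> \<gamma>"
  "qip (std_ext br \<theta>l ip \<rho> \<theta>a z) = std_ip ip"
  "qinv (std_ext br \<theta>l ip \<rho> \<theta>a z) = std_inv \<theta>l \<theta>a"
  "qideal (std_ext br \<theta>l ip \<rho> \<theta>a z) = std_ideal"
  "qinj (std_ext br \<theta>l ip \<rho> \<theta>a z) A = coset std_ideal (0, A, 0)"
  by (simp_all add: std_ext_def split: prod.splits)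

lemma std_ext_proj:
  "qproj (std_ext br \<theta>l ip \<rho> \<theta>a z) (coset std_ideal x) = snd (snd x)"
proof -
  have "(THE L. \<exists>Z A. (Z, A, L) \<in> coset std_ideal x) = snd (snd x)"
    by (rule the_equality)
      (auto simp: mem_coset_std_ideal prod_eq_iff intro: exI[of _ "fst (snd x)"])
  then show ?thesis by (simp add: std_ext_def split: prod.splits)
qed

context invariant_cochains
begin

text \<open>
  The orthogonal complement of the ideal is the set of triples with last component 0, because functionals
  separate the points of \<open>l\<close>; everything else is read off from components.
\<close>

lemma std_ext_is_quad_ext:
  assumes "(\<alpha>, \<gamma>) \<in> Z2Q brl \<theta>l ip \<rho> \<theta>a"
  shows "is_quad_ext brl \<theta>l ip \<rho> \<theta>a (std_ext brl \<theta>l ip \<rho> \<theta>a (\<alpha>, \<gamma>))"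
proof -
  interpret S: metric_lie_algebra_inv sbr "std_ip ip" "std_inv \<theta>l \<theta>a"
    by (rule std_metric_lie_algebra[OF assms])
  let ?I = "std_ideal :: ('l dual \<times> 'a \<times> 'l) set"
  have snd0: "snd x = 0 \<longleftrightarrow> fst (snd x) = 0 \<and> snd (snd x) = 0" for x :: "'l dual \<times> 'a \<times> 'l"
    by (simp add: prod_eq_iff)
  have ideal: "sbr x y \<in> ?I" "sbr y x \<in> ?I" if "y \<in> ?I" for x y
    using that by (simp_all add: mem_std_ideal snd0 std_br_comp' linearity_simps alpha_simps)
  have inv_ideal: "std_inv \<theta>l \<theta>a x \<in> ?I" if "x \<in> ?I" for x
    using that by (simp add: mem_std_ideal snd0 std_inv_comp linearity_simps)
  have inv_ideal_eq: "std_inv \<theta>l \<theta>a ` ?I = ?I"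
    using inv_ideal S.inv_inv by (auto simp: image_iff) metis
  have perp: "orth_compl (std_ip ip) ?I = {x. snd (snd x) = 0}"
  proof (intro set_eqI iffI; simp)
    fix x :: "'l dual \<times> 'a \<times> 'l" assume x: "x \<in> orth_compl (std_ip ip) ?I"
    show "snd (snd x) = 0"
    proof (rule ccontr)
      assume "snd (snd x) \<noteq> 0"
      then obtain f :: "'l \<Rightarrow> real" where f: "linear f" "f (snd (snd x)) \<noteq> 0"
        by (metis linear_functional_nonzero)
      have "(Abs_dual f, 0, 0) \<in> ?I" by (simp add: mem_std_ideal zero_prod_def)
      then show False
        using x f by (force simp: orth_compl_def std_ip_comp linearity_simps dual_app_Abs)
    qed
  next
    fix x :: "'l dual \<times> 'a \<times> 'l" assume "snd (snd x) = 0"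
    then show "x \<in> orth_compl (std_ip ip) ?I"
      by (simp add: orth_compl_def mem_std_ideal snd0 std_ip_comp linearity_simps)
  qed
  have quot_br_eq: "quot_br sbr ?I (coset ?I x) (coset ?I y) = coset ?I (sbr x y)" for x y
    by (rule quot_br_coset[OF subspace_std_ideal std_br_bilinear]) (simp_all add: ideal)
  have img: "std_inv \<theta>l \<theta>a ` coset ?I x = coset ?I (std_inv \<theta>l \<theta>a x)" for x
    using image_coset[OF S.inv_linear] inv_ideal_eq by simp
  have quot_all: "(\<forall>X\<in>quot ?I. P X) \<longleftrightarrow> (\<forall>x. P (coset ?I x))" for P
    by (auto simp: quot_def)
  have inj: "inj (\<lambda>A. coset ?I (0, A, 0))"
    by (rule injI) (simp add: coset_std_ideal_eq_iff)
  have range1: "range (\<lambda>A. coset ?I (0, A, 0)) =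
      {X \<in> quot ?I. qproj (std_ext brl \<theta>l ip \<rho> \<theta>a (\<alpha>, \<gamma>)) X = 0}"
    by (auto simp: quot_def std_ext_proj coset_std_ideal_eq_iff image_iff prod_eq_iff)
  have range2: "range (\<lambda>A. coset ?I (0, A, 0)) = coset ?I ` orth_compl (std_ip ip) ?I"
    unfolding perp by (auto simp: image_iff coset_std_ideal_eq_iff prod_eq_iff)
  have surj: "qproj (std_ext brl \<theta>l ip \<rho> \<theta>a (\<alpha>, \<gamma>)) ` quot ?I = UNIV"
  proof -
    have "x \<in> qproj (std_ext brl \<theta>l ip \<rho> \<theta>a (\<alpha>, \<gamma>)) ` quot ?I" for x
      by (rule image_eqI[of _ _ "coset ?I (0, 0, x)"]) (simp_all add: std_ext_proj)
    then show ?thesis by auto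
  qed
  show ?thesis
    unfolding is_quad_ext_def Let_def std_ext_sel quot_all
    apply (intro conjI)
    subgoal by (rule S.metric_lie_algebra_inv_axioms)
    subgoal by (rule subspace_std_ideal)
    subgoal by (simp add: ideal)
    subgoal using inv_ideal by auto
    subgoal by (simp add: mem_std_ideal snd0 std_ip_comp linearity_simps)
    subgoal by simp
    subgoal by (simp add: quot_add_coset[OF subspace_std_ideal] coset_std_ideal_eq_iff)
    subgoal by (simp add: quot_scale_coset[OF subspace_std_ideal] coset_std_ideal_eq_iff)
    subgoal by (simp add: quot_br_eq coset_std_ideal_eq_iff prod_eq_iff std_br_comp' linearity_simps alpha_simps)
    subgoal by (simp add: img coset_std_ideal_eq_iff prod_eq_iff std_inv_comp linearity_simps)
    subgoal by (simp add: quot_add_coset[OF subspace_std_ideal] std_ext_proj)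
    subgoal by (simp add: quot_scale_coset[OF subspace_std_ideal] std_ext_proj)
    subgoal by (simp add: quot_br_eq std_ext_proj std_br_comp')
    subgoal by (simp add: img std_ext_proj std_inv_comp)
    subgoal by (rule inj)
    subgoal by (rule range1)
    subgoal by (rule surj)
    subgoal by (simp add: quot_br_eq std_ext_proj coset_std_ideal_eq_iff prod_eq_iff std_br_comp' linearity_simps alpha_simps)
    subgoal by (rule range2)
    subgoal by (simp add: mem_coset_std_ideal std_ip_comp linearity_simps)
    done
qed

end

section \<open>Quadratic extensions\<close>

text \<open>
  The maps \<open>p\<close> and \<open>i\<^sup>-\<^sup>1\<close> of an extension live on cosets.  Composed with the quotient map they
  become maps on \<open>g\<close>: \<open>ext_base\<close> is the projection to \<open>l\<close>, and \<open>ext_fibre\<close> is the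
  projection of its kernel to \<open>a\<close>, with arbitrary values outside this kernel.
\<close>

definition ext_base :: "('g::real_vector, 'a, 'l) quad_ext \<Rightarrow> 'g \<Rightarrow> 'l" where
  "ext_base E x = qproj E (coset (qideal E) x)"

definition ext_fibre :: "('g::real_vector, 'a, 'l) quad_ext \<Rightarrow> 'g \<Rightarrow> 'a" where
  "ext_fibre E x = inv (qinj E) (coset (qideal E) x)"

locale quadratic_extension = orthogonal_module brl \<theta>l ip \<rho> \<theta>a
  for brl :: "'l::real_vector \<Rightarrow> 'l \<Rightarrow> 'l"
    and \<theta>l :: "'l \<Rightarrow> 'l"
    and ip :: "'a::real_vector \<Rightarrow> 'a \<Rightarrow> real"
    and \<rho> :: "'l \<Rightarrow> 'a \<Rightarrow> 'a"
    and \<theta>a :: "'a \<Rightarrow> 'a" +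
  fixes E :: "('g::real_vector, 'a, 'l) quad_ext"
  assumes quad_ext: "is_quad_ext brl \<theta>l ip \<rho> \<theta>a E"
begin

sublocale G: metric_lie_algebra_inv "qbr E" "qip E" "qinv E"
  using quad_ext unfolding is_quad_ext_def Let_def by blast

abbreviation "brg \<equiv> qbr E"
abbreviation "ipg \<equiv> qip E"
abbreviation "\<theta>g \<equiv> qinv E"
abbreviation "I \<equiv> qideal E"
abbreviation "base \<equiv> ext_base E"
abbreviation "fibre \<equiv> ext_fibre E"

lemmas quad_ext_unfolded = quad_ext[unfolded is_quad_ext_def Let_def]

lemma subspace_I: "subspace I"
  and ideal_right: "y \<in> I \<Longrightarrow> brg x y \<in> I"
  and inv_I: "x \<in> I \<Longrightarrow> \<theta>g x \<in> I"
  and isotropic_I: "x \<in> I \<Longrightarrow> y \<in> I \<Longrightarrow> ipg x y = 0"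
  and inj_quot: "qinj E A \<in> quot I"
  and inj_add: "qinj E (A + B) = quot_add (qinj E A) (qinj E B)"
  and inj_scale: "qinj E (c *\<^sub>R A) = quot_scale I c (qinj E A)"
  and inj_inv: "qinj E (\<theta>a A) = \<theta>g ` qinj E A"
  and inj_inj: "inj (qinj E)"
  and inj_ip: "x \<in> qinj E A \<Longrightarrow> y \<in> qinj E B \<Longrightarrow> ipg x y = ip A B"
  using quad_ext_unfolded by (simp_all add: image_subset_iff)

lemma ideal_left: "x \<in> I \<Longrightarrow> brg x y \<in> I"
  using ideal_right[of x y] G.br_swap[of x y] subspace_neg[OF subspace_I] by simp

lemma proj_surj: "qproj E ` quot I = UNIV"
  using quad_ext_unfolded by (elim conjE) assumption

lemma inj_perp: "range (qinj E) = coset I ` orth_compl ipg I"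
  using quad_ext_unfolded by (elim conjE) assumption

lemma inj_range: "range (qinj E) = {X \<in> quot I. qproj E X = 0}"
  using quad_ext_unfolded by (elim conjE) assumption

lemma proj_add: "X \<in> quot I \<Longrightarrow> Y \<in> quot I \<Longrightarrow> qproj E (quot_add X Y) = qproj E X + qproj E Y"
  and proj_scale: "X \<in> quot I \<Longrightarrow> qproj E (quot_scale I c X) = c *\<^sub>R qproj E X"
  and proj_br: "X \<in> quot I \<Longrightarrow> Y \<in> quot I \<Longrightarrow> qproj E (quot_br brg I X Y) = brl (qproj E X) (qproj E Y)"
  and proj_inv: "X \<in> quot I \<Longrightarrow> qproj E (\<theta>g ` X) = \<theta>l (qproj E X)"
  and inj_rep: "X \<in> quot I \<Longrightarrow> qinj E (\<rho> (qproj E X) A) = quot_br brg I X (qinj E A)"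
  using quad_ext_unfolded by simp_all

lemma quot_br_eq: "quot_br brg I (coset I x) (coset I y) = coset I (brg x y)"
  by (rule quot_br_coset[OF subspace_I G.br_bilinear]) (simp_all add: ideal_left ideal_right)

lemma inv_I_eq: "\<theta>g ` I = I"
  using inv_I G.inv_inv by (auto simp: image_iff) metis

lemma inv_coset: "\<theta>g ` coset I x = coset I (\<theta>g x)"
  using image_coset[OF G.inv_linear] inv_I_eq by simp

lemma linear_base: "linear base"
  by (rule linearI) (simp_all add: ext_base_def quot_add_coset[OF subspace_I, symmetric]
      quot_scale_coset[OF subspace_I, symmetric] proj_add proj_scale)

lemma base_br: "base (brg x y) = brl (base x) (base y)"
  by (simp add: ext_base_def quot_br_eq[symmetric] proj_br)

lemma base_inv: "base (\<theta>g x) = \<theta>l (base x)"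
  by (simp add: ext_base_def inv_coset[symmetric] proj_inv)

lemma surj_base: "surj base"
  using proj_surj by (auto simp: ext_base_def quot_def image_image)

lemmas base_simps = linear_add[OF linear_base] linear_diff[OF linear_base]
  linear_neg[OF linear_base] linear_scale[OF linear_base] linear_0[OF linear_base]

text \<open>
  This and the following rules replace all reasoning about cosets by reasoning about \<open>ext_base\<close> and
  \<open>ext_fibre\<close>.
\<close>

lemma mem_inj_iff: "x \<in> qinj E A \<longleftrightarrow> base x = 0 \<and> fibre x = A"
proof
  assume x: "x \<in> qinj E A"
  obtain y where y: "qinj E A = coset I y" using inj_quot[of A] by (auto simp: quot_def)
  then have c: "qinj E A = coset I x"
    using x by (simp add: coset_eq_iff[OF subspace_I] mem_coset subspace_diff[OF subspace_I] 
        subspace_neg[OF subspace_I, of "x - y", simplified])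
  then have "qproj E (coset I x) = 0" using inj_range by blast
  moreover have "fibre x = A" by (simp add: ext_fibre_def c[symmetric] inj_inj)
  ultimately show "base x = 0 \<and> fibre x = A" by (simp add: ext_base_def)
next
  assume x: "base x = 0 \<and> fibre x = A"
  then have "coset I x \<in> range (qinj E)" by (simp add: inj_range ext_base_def)
  then have "qinj E (fibre x) = coset I x" by (simp add: ext_fibre_def f_inv_into_f)
  then show "x \<in> qinj E A" using x by (simp add: mem_coset subspace_0[OF subspace_I])
qed

lemma inj_fibre: "base x = 0 \<Longrightarrow> qinj E (fibre x) = coset I x"
  by (simp add: ext_fibre_def f_inv_into_f inj_range ext_base_def)

lemma fibre_eqI: "qinj E A = coset I x \<Longrightarrow> fibre x = A"
  using inv_f_f[OF inj_inj, of A] by (simp add: ext_fibre_def)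

lemma fibre_add: "base x = 0 \<Longrightarrow> base y = 0 \<Longrightarrow> fibre (x + y) = fibre x + fibre y"
  by (rule fibre_eqI) (simp add: inj_add inj_fibre quot_add_coset[OF subspace_I])

lemma fibre_scale: "base x = 0 \<Longrightarrow> fibre (c *\<^sub>R x) = c *\<^sub>R fibre x"
  by (rule fibre_eqI) (simp add: inj_scale inj_fibre quot_scale_coset[OF subspace_I])

lemma fibre_neg: "base x = 0 \<Longrightarrow> fibre (- x) = - fibre x"
  using fibre_scale[of x "-1"] by simp

lemma fibre_diff: "base x = 0 \<Longrightarrow> base y = 0 \<Longrightarrow> fibre (x - y) = fibre x - fibre y"
  using fibre_add[of x "- y"] fibre_neg[of y] by (simp add: base_simps)

lemma fibre_inv: "base x = 0 \<Longrightarrow> fibre (\<theta>g x) = \<theta>a (fibre x)"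
  by (rule fibre_eqI) (simp add: inj_inv inj_fibre inv_coset)

lemma fibre_br: "base y = 0 \<Longrightarrow> fibre (brg x y) = \<rho> (base x) (fibre y)"
  by (rule fibre_eqI) (simp add: ext_base_def inj_rep, simp add: inj_fibre ext_base_def quot_br_eq)

lemma ip_fibre: "base x = 0 \<Longrightarrow> base y = 0 \<Longrightarrow> ip (fibre x) (fibre y) = ipg x y"
  using inj_ip[of x "fibre x" y "fibre y"] by (simp add: mem_inj_iff)

lemma fibre_surj: obtains x where "base x = 0" "fibre x = A"
proof -
  obtain x where "qinj E A = coset I x" using inj_quot[of A] by (auto simp: quot_def)
  then have "x \<in> qinj E A" by (simp add: mem_coset subspace_0[OF subspace_I])
  then show ?thesis using that unfolding mem_inj_iff by blast
qed

lemma mem_I_iff: "x \<in> I \<longleftrightarrow> base x = 0 \<and> fibre x = 0"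
proof -
  have "qinj E 0 = I"
  proof -
    obtain y where y: "qinj E 0 = coset I y" using inj_quot[of 0] by (auto simp: quot_def)
    have "qinj E 0 = coset I 0"
      using inj_scale[of 0 0, unfolded y quot_scale_coset[OF subspace_I]] y by simp
    moreover have "coset I 0 = I" by (simp add: set_eq_iff mem_coset)
    ultimately show ?thesis by simp
  qed
  then show ?thesis using mem_inj_iff[of x 0] by simp
qed

text \<open>
  The kernel of the projection to \<open>l\<close> is \<open>I\<^sup>\<bottom>\<close>, because \<open>i\<close> maps \<open>a\<close> onto both \<open>ker p\<close> and
  \<open>I\<^sup>\<bottom> / I\<close>.
\<close>

lemma base_eq_0_iff: "base x = 0 \<longleftrightarrow> (\<forall>y\<in>I. ipg x y = 0)"
proof
  assume "base x = 0"
  then have "coset I x \<in> coset I ` orth_compl ipg I"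
    unfolding inj_perp[symmetric] by (simp add: inj_range ext_base_def)
  then obtain y where y: "y \<in> orth_compl ipg I" "x - y \<in> I"
    by (auto simp: coset_eq_iff[OF subspace_I])
  show "\<forall>z\<in>I. ipg x z = 0"
  proof
    fix z assume "z \<in> I"
    then have "ipg y z = 0" "ipg (x - y) z = 0" using y isotropic_I by (auto simp: orth_compl_def)
    then show "ipg x z = 0" by (simp add: G.ip_simps)
  qed
next
  assume "\<forall>y\<in>I. ipg x y = 0"
  then have "coset I x \<in> range (qinj E)" unfolding inj_perp by (simp add: orth_compl_def)
  then show "base x = 0" by (simp add: inj_range ext_base_def)
qed

text \<open>
  The ideal is the full dual of \<open>l\<close>.  The vector representing \<open>f \<circ> p\<close> is orthogonal to \<open>I\<^sup>\<bottom>\<close>; since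
  \<open>I\<close> is isotropic it lies in \<open>I\<^sup>\<bottom>\<close>, and its image in \<open>a\<close> is orthogonal to all of \<open>a\<close>, hence 0.
\<close>

lemma dual_represented:
  assumes "linear (f :: 'l \<Rightarrow> real)"
  obtains x where "x \<in> I" "\<And>y. ipg x y = f (base y)"
proof -
  have "linear (\<lambda>y. f (base y))"
    using linear_compose[OF linear_base assms] by (simp add: o_def)
  then obtain x where x: "\<And>y. ipg x y = f (base y)"
    using G.functional_represented[OF G.lie_fin_dim] by blast
  have b: "base x = 0"
    unfolding base_eq_0_iff using x linear_0[OF assms] by (simp add: mem_I_iff)
  have "ip (fibre x) A = 0" for A
  proof -
    obtain y where y: "base y = 0" "fibre y = A" by (rule fibre_surj)
    then show ?thesis using ip_fibre[OF b y(1)] x[of y] linear_0[OF assms] by simp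
  qed
  then have "x \<in> I" using b A.ip_nondegenerate by (simp add: mem_I_iff)
  then show ?thesis using that x by blast
qed

end

section \<open>Adapted sections\<close>

text \<open>
  For a section \<open>s\<close> of the projection to \<open>l\<close>, the components of \<open>[s x, s y]\<close> in \<open>a\<close> and in the dual
  of \<open>l\<close> with respect to the decomposition of \<open>g\<close> that \<open>s\<close> induces.
\<close>

definition section_cocycle ::
  "('l::real_vector \<Rightarrow> 'l \<Rightarrow> 'l) \<Rightarrow> ('g::real_vector, 'a::real_vector, 'l) quad_ext \<Rightarrow> ('l \<Rightarrow> 'g) \<Rightarrow>
   ('l list \<Rightarrow> 'a) \<times> ('l list \<Rightarrow> real)" where
  "section_cocycle br E s =
     ((\<lambda>xs. case xs of [x, y] \<Rightarrow> ext_fibre E (qbr E (s x) (s y) - s (br x y)) | _ \<Rightarrow> 0),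
      (\<lambda>xs. case xs of [x, y, z] \<Rightarrow> qip E (qbr E (s x) (s y)) (s z) | _ \<Rightarrow> 0))"

locale adapted_section = quadratic_extension brl \<theta>l ip \<rho> \<theta>a E
  for brl :: "'l::real_vector \<Rightarrow> 'l \<Rightarrow> 'l"
    and \<theta>l :: "'l \<Rightarrow> 'l"
    and ip :: "'a::real_vector \<Rightarrow> 'a \<Rightarrow> real"
    and \<rho> :: "'l \<Rightarrow> 'a \<Rightarrow> 'a"
    and \<theta>a :: "'a \<Rightarrow> 'a"
    and E :: "('g::real_vector, 'a, 'l) quad_ext" +
  fixes s :: "'l \<Rightarrow> 'g"
  assumes s_linear: "linear s"
    and s_base: "ext_base E (s x) = x"
    and s_inv: "qinv E (s x) = s (\<theta>l x)"
    and s_isotropic: "qip E (s x) (s y) = 0"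
begin

lemmas s_simps = linear_add[OF s_linear] linear_diff[OF s_linear]
  linear_neg[OF s_linear] linear_scale[OF s_linear] linear_0[OF s_linear]

abbreviation "\<alpha>s \<equiv> fst (section_cocycle brl E s)"
abbreviation "\<gamma>s \<equiv> snd (section_cocycle brl E s)"

lemma alpha_s: "\<alpha>s [x, y] = fibre (brg (s x) (s y) - s (brl x y))"
  and gamma_s: "\<gamma>s [x, y, z] = ipg (brg (s x) (s y)) (s z)"
  by (simp_all add: section_cocycle_def)

lemma base_defect: "base (brg (s x) (s y) - s (brl x y)) = 0"
  by (simp add: base_simps base_br s_base)

lemma section_cocycle_plus: "\<alpha>s \<in> cochains_plus \<theta>l \<theta>a 2" "\<gamma>s \<in> cochains_plus \<theta>l id 3"
proof -
  have a0: "\<alpha>s xs = 0" if "length xs \<noteq> 2" for xs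
    using that by (auto simp: section_cocycle_def split: list.splits)
  have g0: "\<gamma>s xs = 0" if "length xs \<noteq> 3" for xs
    using that by (auto simp: section_cocycle_def split: list.splits)
  have "bilinear (\<lambda>x y. \<alpha>s [x, y])"
    unfolding bilinear_def alpha_s
  proof (intro conjI allI linearI)
    fix x y z and c :: real
    have 1: "brg (s (x + y)) (s z) - s (brl (x + y) z) =
        (brg (s x) (s z) - s (brl x z)) + (brg (s y) (s z) - s (brl y z))"
      "brg (s z) (s (x + y)) - s (brl z (x + y)) =
        (brg (s z) (s x) - s (brl z x)) + (brg (s z) (s y) - s (brl z y))"
      "brg (s (c *\<^sub>R x)) (s z) - s (brl (c *\<^sub>R x) z) = c *\<^sub>R (brg (s x) (s z) - s (brl x z))"
      "brg (s z) (s (c *\<^sub>R x)) - s (brl z (c *\<^sub>R x)) = c *\<^sub>R (brg (s z) (s x) - s (brl z x))"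
      by (simp_all add: G.br_simps L.br_simps s_simps algebra_simps)
    show "fibre (brg (s (x + y)) (s z) - s (brl (x + y) z)) =
        fibre (brg (s x) (s z) - s (brl x z)) + fibre (brg (s y) (s z) - s (brl y z))"
      "fibre (brg (s z) (s (x + y)) - s (brl z (x + y))) =
        fibre (brg (s z) (s x) - s (brl z x)) + fibre (brg (s z) (s y) - s (brl z y))"
      "fibre (brg (s (c *\<^sub>R x)) (s z) - s (brl (c *\<^sub>R x) z)) = c *\<^sub>R fibre (brg (s x) (s z) - s (brl x z))"
      "fibre (brg (s z) (s (c *\<^sub>R x)) - s (brl z (c *\<^sub>R x))) = c *\<^sub>R fibre (brg (s z) (s x) - s (brl z x))"
      unfolding 1 by (simp_all add: fibre_add fibre_scale base_defect)
  qed
  moreover have "\<alpha>s [x, x] = 0" for x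
    using mem_I_iff[of 0] subspace_0[OF subspace_I]
    by (simp add: alpha_s G.br_alternating L.br_alternating s_simps)
  ultimately have "\<alpha>s \<in> cochains 2" using a0 by (simp add: cochains_2_iff)
  moreover have "cochain_inv \<theta>l \<theta>a \<alpha>s xs = \<alpha>s xs" for xs
  proof (cases "length xs = 2")
    case True
    then obtain x y where xs: "xs = [x, y]" by (auto simp: list_len2)
    have "\<alpha>s [\<theta>l x, \<theta>l y] = fibre (\<theta>g (brg (s x) (s y) - s (brl x y)))"
      by (simp add: alpha_s G.inv_br L.inv_br s_inv linear_diff[OF G.inv_linear])
    then show ?thesis
      by (simp add: xs cochain_inv_def fibre_inv base_defect mod_inv_inv alpha_s)
  qed (simp add: cochain_inv_def a0 mod_inv_simps)
  ultimately show "\<alpha>s \<in> cochains_plus \<theta>l \<theta>a 2" by (auto simp: cochains_plus_def)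
  have "\<gamma>s [x, y, y] = 0" for x y
    using G.ip_invariant[of "s x" "s y" "s y"] by (simp add: gamma_s G.ip_sym[of "s y"])
  moreover from this have "\<gamma>s [x, y, x] = 0" for x y
    by (simp add: gamma_s G.br_swap[of "s x" "s y"] G.ip_simps)
  ultimately have "\<gamma>s \<in> cochains 3" using g0
    by (simp add: cochains_3_iff) (simp add: gamma_s G.br_alternating G.ip_simps G.br_simps s_simps linear_iff)
  moreover have "cochain_inv \<theta>l id \<gamma>s xs = \<gamma>s xs" for xs
  proof (cases "length xs = 3")
    case True
    then obtain x y z where xs: "xs = [x, y, z]" by (auto simp: list_len3)
    show ?thesis
      by (simp add: xs cochain_inv_def gamma_s s_inv[symmetric] G.inv_br[symmetric] G.inv_isometry)
  qed (simp add: cochain_inv_def g0)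
  ultimately show "\<gamma>s \<in> cochains_plus \<theta>l id 3" by (auto simp: cochains_plus_def)
qed

sublocale C: invariant_cochains brl \<theta>l ip \<rho> \<theta>a \<alpha>s \<gamma>s
  by unfold_locales (rule section_cocycle_plus)+

text \<open>
  Subtracting \<open>s (base u)\<close> moves \<open>u\<close> into \<open>I\<^sup>\<bottom>\<close>, where the fibre is defined; the dual component is
  unchanged by this shift because the image of \<open>s\<close> is isotropic.
\<close>

definition coord :: "'g \<Rightarrow> 'l dual \<times> 'a \<times> 'l" where
  "coord u = (Abs_dual (\<lambda>M. ipg u (s M)), fibre (u - s (base u)), base u)"

lemma base_vertical: "base (u - s (base u)) = 0"
  by (simp add: base_simps s_base)

lemma coord_comp:
  "dual_app (fst (coord u)) M = ipg u (s M)"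
  "fst (snd (coord u)) = fibre (u - s (base u))"
  "snd (snd (coord u)) = base u"
proof -
  have "linear (\<lambda>M. ipg u (s M))"
    using linear_compose[OF s_linear G.linear_ip[of u]] by (simp add: o_def)
  then show "dual_app (fst (coord u)) M = ipg u (s M)" by (simp add: coord_def dual_app_Abs)
qed (simp_all add: coord_def)

lemma linear_coord: "linear coord"
proof (rule linearI; rule triple_eqI)
  fix u v and c :: real
  have 1: "u + v - s (base (u + v)) = (u - s (base u)) + (v - s (base v))"
    "c *\<^sub>R u - s (base (c *\<^sub>R u)) = c *\<^sub>R (u - s (base u))"
    by (simp_all add: base_simps s_simps algebra_simps)
  show "fst (snd (coord (u + v))) = fst (snd (coord u + coord v))"
    "fst (snd (coord (c *\<^sub>R u))) = fst (snd (c *\<^sub>R coord u))"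
    unfolding coord_comp 1 by (simp_all add: coord_comp fibre_add fibre_scale base_vertical)
qed (simp_all add: coord_comp dual_simps base_simps G.ip_simps)

lemma coord_isometry: "std_ip ip (coord u) (coord v) = ipg u v"
proof -
  have "ip (fibre (u - s (base u))) (fibre (v - s (base v))) = ipg (u - s (base u)) (v - s (base v))"
    by (simp add: ip_fibre base_vertical)
  then show ?thesis
    by (simp add: std_ip_comp coord_comp G.ip_simps s_isotropic G.ip_sym[of "s (base u)"])
qed

lemma inj_coord: "inj coord"
proof -
  have "u = 0" if "coord u = 0" for u
    using coord_isometry[of u] that by (intro G.ip_nondegenerate) (simp add: std_ip_comp linearity_simps flip: coord_isometry)
  then show ?thesis using linear_injective_0[OF linear_coord] by blast
qed

text \<open>
  A lift of the component in \<open>a\<close> can be corrected by an element of the ideal to have any prescribed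
  products with the image of \<open>s\<close>.
\<close>

lemma surj_coord: "surj coord"
proof -
  have "\<exists>u. x = coord u" for x
  proof -
    obtain y where y: "base y = 0" "fibre y = fst (snd x)" by (rule fibre_surj)
    have "linear (\<lambda>M. dual_app (fst x) M - ipg y (s M))"
      by (intro linear_compose_sub linear_dual_app)
        (use linear_compose[OF s_linear G.linear_ip[of y]] in \<open>simp add: o_def\<close>)
    then obtain j where j: "j \<in> I" "\<And>z. ipg j z = dual_app (fst x) (base z) - ipg y (s (base z))"
      by (rule dual_represented) (rule that; assumption)
    from j(1) have j0: "base j = 0" "fibre j = 0" by (simp_all add: mem_I_iff)
    have "x = coord (s (snd (snd x)) + y + j)"
      by (rule triple_eqI)
        (simp_all add: coord_comp base_simps s_base y j0 G.ip_simps s_isotropic j(2) fibre_add)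
    then show ?thesis by blast
  qed
  then show ?thesis unfolding surj_def by blast
qed

lemma coord_inv: "coord (\<theta>g u) = std_inv \<theta>l \<theta>a (coord u)"
proof (rule triple_eqI)
  have "\<theta>g u - s (base (\<theta>g u)) = \<theta>g (u - s (base u))"
    by (simp add: linear_diff[OF G.inv_linear] s_inv base_inv)
  then show "fst (snd (coord (\<theta>g u))) = fst (snd (std_inv \<theta>l \<theta>a (coord u)))"
    by (simp add: coord_comp std_inv_comp fibre_inv base_vertical)
  show "dual_app (fst (coord (\<theta>g u))) M = dual_app (fst (std_inv \<theta>l \<theta>a (coord u))) M" for M
    using G.inv_isometry[of u "\<theta>g (s M)"]
    by (simp add: coord_comp std_inv_comp s_inv L.inv_inv)
qed (simp add: coord_comp std_inv_comp base_inv)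

lemma ip_vertical_br_section:
  assumes "base v = 0"
  shows "ipg v (brg (s x) (s y)) = ipg v (s (brl x y)) + ip (fibre v) (\<alpha>s [x, y])"
  using ip_fibre[OF assms base_defect[of x y]] by (simp add: alpha_s G.ip_simps)

text \<open>
  Split both arguments as \<open>s L + u'\<close> with \<open>u'\<close> in \<open>I\<^sup>\<bottom>\<close>.  Modulo \<open>I\<close> the module structure determines
  the mixed brackets.  Their products with \<open>s N\<close> follow from ad-invariance, which moves the bracket
  onto \<open>s\<close>, where it is known up to \<open>\<alpha>\<close>.
\<close>

lemma coord_br: "coord (brg u v) = C.sbr (coord u) (coord v)"
proof -
  define u' where "u' = u - s (base u)"
  define v' where "v' = v - s (base v)"
  have u: "u = s (base u) + u'" and v: "v = s (base v) + v'" by (simp_all add: u'_def v'_def)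
  have b: "base u' = 0" "base v' = 0" by (simp_all add: u'_def v'_def base_vertical)
  let ?L = "base u" and ?M = "base v"
  have br: "brg u v = brg (s ?L) (s ?M) + brg (s ?L) v' - brg (s ?M) u' + brg u' v'"
    by (subst u, subst v) (simp add: G.br_simps G.br_swap[of "s ?M" u'])
  have fib: "fibre (brg u v - s (base (brg u v))) = \<alpha>s [?L, ?M] + \<rho> ?L (fibre v') - \<rho> ?M (fibre u')"
  proof -
    have eq: "brg u v - s (base (brg u v)) =
        (brg (s ?L) (s ?M) - s (brl ?L ?M)) + brg (s ?L) v' - brg (s ?M) u' + brg u' v'"
      unfolding base_br by (simp add: br)
    show ?thesis
      unfolding eq by (simp add: fibre_add fibre_diff fibre_br base_simps base_br base_defect b s_base
          L.br_simps rep_simps alpha_s)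
  qed
  have dual: "ipg (brg u v) (s N) = \<gamma>s [?L, ?M, N]
      - ip (fibre v') (\<alpha>s [?L, N]) + ip (fibre u') (\<alpha>s [?M, N])
      - ipg v (s (brl ?L N)) + ipg u (s (brl ?M N)) + ip (\<rho> N (fibre u')) (fibre v')" for N
  proof -
    have 1: "ipg (brg (s ?L) v') (s N) = - ipg v' (s (brl ?L N)) - ip (fibre v') (\<alpha>s [?L, N])"
      using G.ip_invariant[of "s ?L" v' "s N"] ip_vertical_br_section[OF b(2)] by simp
    have 2: "ipg (brg (s ?M) u') (s N) = - ipg u' (s (brl ?M N)) - ip (fibre u') (\<alpha>s [?M, N])"
      using G.ip_invariant[of "s ?M" u' "s N"] ip_vertical_br_section[OF b(1)] by simp
    have 3: "ipg (brg u' v') (s N) = ip (\<rho> N (fibre u')) (fibre v')"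
      using G.ip_invariant[of u' v' "s N"] ip_fibre[of "brg (s N) u'" v']
      by (simp add: fibre_br b s_base base_br L.br_simps G.br_swap[of u' "s N"] G.ip_simps
          G.ip_sym[of v'])
    have 4: "ipg v (s K) = ipg v' (s K)" "ipg u (s K) = ipg u' (s K)" for K
      by (simp_all add: u'_def v'_def G.ip_simps s_isotropic)
    show ?thesis
      unfolding 4 by (simp add: br G.ip_simps 1 2 3 gamma_s)
  qed
  show ?thesis
    by (rule triple_eqI)
      (simp_all add: coord_comp C.std_br_comp' fib[unfolded base_br] dual base_br flip: u'_def v'_def)
qed

text \<open>
  The bracket of the model is the bracket of \<open>g\<close> in other coordinates, so it satisfies the Jacobi
  identity.
\<close>

lemma section_cocycle_Z2Q: "section_cocycle brl E s \<in> Z2Q brl \<theta>l ip \<rho> \<theta>a"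
proof -
  have "C.sbr x (C.sbr y z) + C.sbr y (C.sbr z x) + C.sbr z (C.sbr x y) = 0" for x y z
  proof -
    obtain u v w where "x = coord u" "y = coord v" "z = coord w"
      using surj_coord by (metis surjD)
    then show ?thesis
      by (simp add: coord_br[symmetric] linear_add[OF linear_coord, symmetric] G.br_jacobi
          linear_0[OF linear_coord])
  qed
  then show ?thesis using C.Z2Q_if_jacobi by simp
qed

lemma ext_equiv_section_cocycle:
  "ext_equiv E (std_ext brl \<theta>l ip \<rho> \<theta>a (section_cocycle brl E s))"
proof -
  have c: "section_cocycle brl E s = (\<alpha>s, \<gamma>s)" by simp
  have snd0: "snd (coord u) = (A, 0) \<longleftrightarrow> base u = 0 \<and> fibre u = A" for u A
    by (auto simp: prod_eq_iff coord_comp s_simps)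
  have img: "coord ` X = Y" if "\<And>u. u \<in> X \<longleftrightarrow> coord u \<in> Y" for X Y
    using that surj_coord by (auto simp: image_iff) (metis surjD)
  show ?thesis
    unfolding ext_equiv_def
  proof (intro exI[of _ coord] conjI allI ballI)
    show "linear coord" by (rule linear_coord)
    show "bij coord" using inj_coord surj_coord by (simp add: bij_def)
    show "coord (brg x y) = qbr (std_ext brl \<theta>l ip \<rho> \<theta>a (section_cocycle brl E s)) (coord x) (coord y)" for x y
      by (subst c) (simp only: std_ext_sel coord_br)
    show "qip (std_ext brl \<theta>l ip \<rho> \<theta>a (section_cocycle brl E s)) (coord x) (coord y) = ipg x y" for x y
      by (simp add: std_ext_sel coord_isometry)
    show "coord (\<theta>g x) = qinv (std_ext brl \<theta>l ip \<rho> \<theta>a (section_cocycle brl E s)) (coord x)" for x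
      by (simp add: std_ext_sel coord_inv)
    show "coord ` I = qideal (std_ext brl \<theta>l ip \<rho> \<theta>a (section_cocycle brl E s))"
      unfolding std_ext_sel
      by (rule img) (simp add: mem_I_iff mem_std_ideal snd0[of _ 0, folded zero_prod_def])
    show "coord ` qinj E A = qinj (std_ext brl \<theta>l ip \<rho> \<theta>a (section_cocycle brl E s)) A" for A
      unfolding std_ext_sel
      by (rule img) (simp add: mem_inj_iff mem_coset_std_ideal snd0)
    fix X assume "X \<in> quot I"
    then obtain x where x: "X = coset I x" by (auto simp: quot_def)
    have "coord ` X = coset std_ideal (coord x)"
      unfolding x
      by (rule img) (simp add: mem_coset mem_I_iff mem_std_ideal snd0[of _ 0, folded zero_prod_def]
          flip: linear_diff[OF linear_coord] snd_diff)
    then show "qproj (std_ext brl \<theta>l ip \<rho> \<theta>a (section_cocycle brl E s)) (coord ` X) = qproj E X"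
      by (simp add: std_ext_proj coord_comp x ext_base_def)
  qed
qed

end

context quadratic_extension
begin

lemma adapted_sectionI:
  assumes "linear s" "\<And>x. base (s x) = x" "\<And>x. \<theta>g (s x) = s (\<theta>l x)" "\<And>x y. ipg (s x) (s y) = 0"
  shows "adapted_section brl \<theta>l ip \<rho> \<theta>a E s"
  using assms quadratic_extension_axioms
  by (simp add: adapted_section_def adapted_section_axioms_def)

text \<open>
  Averaging an arbitrary splitting over the involution makes it equivariant.  If \<open>h x\<close> in \<open>I\<close>
  represents the functional \<open>\<langle>s\<^sub>1 x, s\<^sub>1 \<cdot>\<rangle>\<close>, then \<open>s\<^sub>1 - h/2\<close> is isotropic: the two cross terms
  each remove half of \<open>\<langle>s\<^sub>1 x, s\<^sub>1 y\<rangle>\<close>, and \<open>h\<close> contributes no quadratic term as \<open>I\<close> is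
  isotropic.  By uniqueness of the representing vector \<open>h\<close> inherits linearity and equivariance.
\<close>

lemma adapted_section_exists: "\<exists>s. adapted_section brl \<theta>l ip \<rho> \<theta>a E s"
proof -
  obtain s0 where s0: "linear s0" "base \<circ> s0 = id"
    using linear_surjective_right_inverse[OF linear_base surj_base] by blast
  have s0_base: "base (s0 x) = x" for x using s0(2) by (metis comp_apply id_apply)
  define s1 where "s1 x = (1/2) *\<^sub>R (s0 x + \<theta>g (s0 (\<theta>l x)))" for x
  have s1_linear: "linear s1"
    by (rule linearI)
      (simp_all add: s1_def linear_add[OF s0(1)] linear_scale[OF s0(1)] linear_add[OF G.inv_linear]
        linear_scale[OF G.inv_linear] mod_inv_simps algebra_simps)
  have s1_base: "base (s1 x) = x" for x
    by (simp add: s1_def base_simps base_inv s0_base L.inv_inv flip: scaleR_2)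
  have s1_inv: "\<theta>g (s1 x) = s1 (\<theta>l x)" for x
    by (simp add: s1_def linear_add[OF G.inv_linear] linear_scale[OF G.inv_linear] G.inv_inv
        L.inv_inv add.commute)
  have "\<exists>j. j \<in> I \<and> (\<forall>y. ipg j y = ipg (s1 x) (s1 (base y)))" for x
  proof -
    have "linear (\<lambda>M. ipg (s1 x) (s1 M))"
      using linear_compose[OF s1_linear G.linear_ip[of "s1 x"]] by (simp add: o_def)
    from dual_represented[OF this] show ?thesis by metis
  qed
  then obtain h where h: "\<And>x. h x \<in> I" "\<And>x y. ipg (h x) y = ipg (s1 x) (s1 (base y))"
    by metis
  have h_linear: "linear h"
    by (rule linearI; rule G.ip_eqI)
      (simp_all add: h(2) G.ip_simps linear_add[OF s1_linear] linear_scale[OF s1_linear])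
  have h_base: "base (h x) = 0" for x using h(1) by (simp add: mem_I_iff)
  have h_inv: "\<theta>g (h x) = h (\<theta>l x)" for x
  proof (rule G.ip_eqI)
    fix y
    have "ipg (\<theta>g (h x)) y = ipg (h x) (\<theta>g y)"
      using G.inv_isometry[of "h x" "\<theta>g y"] by (simp add: G.inv_inv)
    also have "\<dots> = ipg (s1 x) (\<theta>g (s1 (base y)))" by (simp add: h(2) base_inv s1_inv)
    also have "\<dots> = ipg (\<theta>g (s1 x)) (s1 (base y))"
      using G.inv_isometry[of "s1 x" "\<theta>g (s1 (base y))"] by (simp add: G.inv_inv)
    finally show "ipg (\<theta>g (h x)) y = ipg (h (\<theta>l x)) y" by (simp add: h(2) s1_inv)
  qed
  define s where "s x = s1 x - (1/2) *\<^sub>R h x" for x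
  have "adapted_section brl \<theta>l ip \<rho> \<theta>a E s"
  proof (rule adapted_sectionI)
    show "linear s"
      by (rule linearI) (simp_all add: s_def linear_add[OF s1_linear] linear_scale[OF s1_linear]
          linear_add[OF h_linear] linear_scale[OF h_linear] algebra_simps)
    show "base (s x) = x" for x by (simp add: s_def base_simps s1_base h_base)
    show "\<theta>g (s x) = s (\<theta>l x)" for x
      by (simp add: s_def linear_diff[OF G.inv_linear] linear_scale[OF G.inv_linear] s1_inv h_inv)
    show "ipg (s x) (s y) = 0" for x y
      using h(2)[of y "s1 x"]
      by (simp add: s_def G.ip_simps h(2) s1_base h_base G.ip_sym[of _ "h y"] linear_0[OF s1_linear] G.ip_sym[of "s1 y"])
  qed
  then show ?thesis by blast
qed

text \<open>
  The section \<open>x \<mapsto> (0, 0, x)\<close> of the standard model is adapted and has cocycle \<open>z\<close>; both properties are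
  pulled back along the equivalence.
\<close>

lemma adapted_section_of_equiv:
  assumes equiv: "ext_equiv E (std_ext brl \<theta>l ip \<rho> \<theta>a z)" and z: "z \<in> Z2Q brl \<theta>l ip \<rho> \<theta>a"
  shows "\<exists>s. adapted_section brl \<theta>l ip \<rho> \<theta>a E s \<and> section_cocycle brl E s = z"
proof -
  obtain \<alpha> \<gamma> where z_eq: "z = (\<alpha>, \<gamma>)" by (cases z)
  interpret C: invariant_cochains brl \<theta>l ip \<rho> \<theta>a \<alpha> \<gamma>
    using z by (simp add: z_eq Z2Q_iff)
  obtain \<Psi> where \<Psi>: "linear \<Psi>" "bij \<Psi>"
    and br: "\<And>x y. \<Psi> (brg x y) = C.sbr (\<Psi> x) (\<Psi> y)"
    and ip: "\<And>x y. std_ip ip (\<Psi> x) (\<Psi> y) = ipg x y"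
    and inv: "\<And>x. \<Psi> (\<theta>g x) = std_inv \<theta>l \<theta>a (\<Psi> x)"
    and ideal: "\<Psi> ` I = std_ideal"
    and inj: "\<And>A. \<Psi> ` qinj E A = coset std_ideal (0, A, 0)"
    and proj: "\<And>X. X \<in> quot I \<Longrightarrow> qproj (std_ext brl \<theta>l ip \<rho> \<theta>a z) (\<Psi> ` X) = qproj E X"
    by (rule ext_equivE[OF equiv, unfolded z_eq std_ext_sel]) (rule that; simp add: z_eq)
  have base_eq: "base u = snd (snd (\<Psi> u))" for u
    using proj[of "coset I u"] by (simp add: image_coset[OF \<Psi>(1)] ideal std_ext_proj ext_base_def)
  have fibre_eq: "fibre u = fst (snd (\<Psi> u))" if "base u = 0" for u
  proof -
    have "\<Psi> u \<in> \<Psi> ` qinj E (fibre u)" using that by (simp add: mem_inj_iff)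
    then show ?thesis by (simp add: inj mem_coset_std_ideal)
  qed
  define s where "s x = inv \<Psi> (0, 0, x)" for x
  have \<Psi>s: "\<Psi> (s x) = (0, 0, x)" for x
    using \<Psi>(2) by (simp add: s_def bij_is_surj surj_f_inv_f)
  have inj\<Psi>: "\<Psi> u = \<Psi> v \<Longrightarrow> u = v" for u v
    using \<Psi>(2) by (simp add: bij_is_inj inj_eq)
  interpret s: adapted_section brl \<theta>l ip \<rho> \<theta>a E s
  proof (rule adapted_sectionI)
    show "linear s"
      by (rule linearI; rule inj\<Psi>) (simp_all add: \<Psi>s linear_add[OF \<Psi>(1)] linear_scale[OF \<Psi>(1)])
    show "base (s x) = x" for x by (simp add: base_eq \<Psi>s)
    show "\<theta>g (s x) = s (\<theta>l x)" for x
      by (rule inj\<Psi>, rule triple_eqI) (simp_all add: inv \<Psi>s std_inv_comp linearity_simps)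
    show "ipg (s x) (s y) = 0" for x y
      by (simp add: \<Psi>s std_ip_comp linearity_simps flip: ip)
  qed
  have "s.\<alpha>s xs = \<alpha> xs" for xs
  proof (cases "length xs = 2")
    case True
    then obtain x y where xs: "xs = [x, y]" by (auto simp: list_len2)
    show ?thesis
      by (simp add: xs s.alpha_s fibre_eq s.base_defect linear_diff[OF \<Psi>(1)] br \<Psi>s C.std_br_comp' linearity_simps)
  qed (simp add: cochains_wrong_length[OF C.alpha_cochain] cochains_wrong_length[OF s.C.alpha_cochain])
  moreover have "s.\<gamma>s xs = \<gamma> xs" for xs
  proof (cases "length xs = 3")
    case True
    then obtain x y w where xs: "xs = [x, y, w]" by (auto simp: list_len3)
    show ?thesis
      by (simp add: xs s.gamma_s br \<Psi>s std_ip_comp C.std_br_comp' linearity_simps flip: ip)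
  qed (simp add: cochains_wrong_length[OF C.gamma_cochain] cochains_wrong_length[OF s.C.gamma_cochain])
  ultimately have "section_cocycle brl E s = z" by (simp add: z_eq prod_eq_iff fun_eq_iff)
  then show ?thesis using s.adapted_section_axioms by blast
qed

end

section \<open>Adapted sections of the standard model\<close>

locale quadratic_cocycle = invariant_cochains brl \<theta>l ip \<rho> \<theta>a \<alpha> \<gamma>
  for brl :: "'l::real_vector \<Rightarrow> 'l \<Rightarrow> 'l"
    and \<theta>l :: "'l \<Rightarrow> 'l"
    and ip :: "'a::real_vector \<Rightarrow> 'a \<Rightarrow> real"
    and \<rho> :: "'l \<Rightarrow> 'a \<Rightarrow> 'a"
    and \<theta>a :: "'a \<Rightarrow> 'a"
    and \<alpha> :: "'l list \<Rightarrow> 'a" and \<gamma> :: "'l list \<Rightarrow> real" +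
  assumes cocycle: "(\<alpha>, \<gamma>) \<in> Z2Q brl \<theta>l ip \<rho> \<theta>a"
begin

abbreviation "D \<equiv> std_ext brl \<theta>l ip \<rho> \<theta>a (\<alpha>, \<gamma>)"

sublocale D: quadratic_extension brl \<theta>l ip \<rho> \<theta>a D
  by unfold_locales (rule std_ext_is_quad_ext[OF cocycle])

lemma std_base: "ext_base D x = snd (snd x)"
  by (simp add: ext_base_def std_ext_sel std_ext_proj)

lemma std_fibre: "snd (snd x) = 0 \<Longrightarrow> ext_fibre D x = fst (snd x)"
  by (rule D.fibre_eqI) (simp add: std_ext_sel coset_std_ideal_eq_iff prod_eq_iff)

text \<open>
  The correction \<open>- 1/2 \<langle>\<tau> x, \<tau> y\<rangle>\<close> cancels the product of the components in \<open>a\<close>; the remaining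
  freedom in an isotropic section is the alternating form \<open>\<sigma>\<close>.
\<close>

definition std_section :: "('l list \<Rightarrow> 'a) \<times> ('l list \<Rightarrow> real) \<Rightarrow> 'l \<Rightarrow> 'l dual \<times> 'a \<times> 'l" where
  "std_section = (\<lambda>(\<tau>, \<sigma>) x.
     (Abs_dual (\<lambda>y. \<sigma> [x, y] - 1/2 * ip (\<tau> [x]) (\<tau> [y])), \<tau> [x], x))"

lemma C1Q_iff:
  "(\<tau>, \<sigma>) \<in> C1Q \<theta>l \<theta>a \<longleftrightarrow> \<tau> \<in> cochains 1 \<and> \<sigma> \<in> cochains 2 \<and>
     (\<forall>x. \<tau> [\<theta>l x] = \<theta>a (\<tau> [x])) \<and> (\<forall>x y. \<sigma> [\<theta>l x, \<theta>l y] = \<sigma> [x, y])" (is "?l \<longleftrightarrow> ?r")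
proof
  assume l: ?l
  then have "cochain_inv \<theta>l \<theta>a \<tau> [x] = \<tau> [x]" "cochain_inv \<theta>l id \<sigma> [x, y] = \<sigma> [x, y]" for x y
    by (simp_all add: C1Q_def cochains_plus_def)
  then have "\<theta>a (\<tau> [\<theta>l x]) = \<tau> [x]" "\<sigma> [\<theta>l x, \<theta>l y] = \<sigma> [x, y]" for x y
    by (simp_all add: cochain_inv_def)
  then have "\<forall>x. \<tau> [\<theta>l x] = \<theta>a (\<tau> [x])" "\<forall>x y. \<sigma> [\<theta>l x, \<theta>l y] = \<sigma> [x, y]"
    by (metis mod_inv_inv)+
  then show ?r using l by (simp add: C1Q_def cochains_plus_def)
next
  assume r: ?r
  have "cochain_inv \<theta>l \<theta>a \<tau> xs = \<tau> xs" for xs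
  proof (cases "length xs = 1")
    case True
    then show ?thesis using r by (auto simp: list_len1 cochain_inv_def mod_inv_inv)
  qed (use r in \<open>simp add: cochain_inv_def mod_inv_simps cochains_wrong_length[of _ 1]\<close>)
  moreover have "cochain_inv \<theta>l id \<sigma> xs = \<sigma> xs" for xs
  proof (cases "length xs = 2")
    case True
    then show ?thesis using r by (auto simp: list_len2 cochain_inv_def)
  qed (use r in \<open>simp add: cochain_inv_def cochains_wrong_length[of _ 2]\<close>)
  ultimately show ?l using r by (auto simp: C1Q_def cochains_plus_def)
qed

context
  fixes \<tau> :: "'l list \<Rightarrow> 'a" and \<sigma> :: "'l list \<Rightarrow> real"
  assumes c: "(\<tau>, \<sigma>) \<in> C1Q \<theta>l \<theta>a"
begin

lemma tau_linear: "linear (\<lambda>x. \<tau> [x])"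
  using c by (simp add: C1Q_iff cochains_1_iff del: One_nat_def)

lemma sigma_bilinear: "bilinear (\<lambda>x y. \<sigma> [x, y])"
  using c by (simp add: C1Q_iff cochains_2_iff)

lemmas tau_simps = linear_add[OF tau_linear] linear_diff[OF tau_linear] linear_neg[OF tau_linear]
  linear_scale[OF tau_linear] linear_0[OF tau_linear]

lemmas sigma_simps = bilinear_ladd[OF sigma_bilinear] bilinear_radd[OF sigma_bilinear]
  bilinear_lsub[OF sigma_bilinear] bilinear_rsub[OF sigma_bilinear]
  bilinear_lneg[OF sigma_bilinear] bilinear_rneg[OF sigma_bilinear]
  bilinear_lmul[OF sigma_bilinear] bilinear_rmul[OF sigma_bilinear]
  bilinear_lzero[OF sigma_bilinear] bilinear_rzero[OF sigma_bilinear]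

lemma sigma_same: "\<sigma> [x, x] = 0"
  using c by (simp add: C1Q_iff cochains_2_iff)

lemma sigma_swap: "\<sigma> [y, x] = - \<sigma> [x, y]"
  using sigma_same[of "x + y"] sigma_same[of x] sigma_same[of y] by (simp add: sigma_simps)

lemma tau_sigma_inv: "\<tau> [\<theta>l x] = \<theta>a (\<tau> [x])" "\<sigma> [\<theta>l x, \<theta>l y] = \<sigma> [x, y]"
  using c by (simp_all add: C1Q_iff)

lemma std_section_comp:
  "dual_app (fst (std_section (\<tau>, \<sigma>) x)) y = \<sigma> [x, y] - 1/2 * ip (\<tau> [x]) (\<tau> [y])"
  "fst (snd (std_section (\<tau>, \<sigma>) x)) = \<tau> [x]"
  "snd (snd (std_section (\<tau>, \<sigma>) x)) = x"
proof -
  have "linear (\<lambda>y. \<sigma> [x, y] - 1/2 * ip (\<tau> [x]) (\<tau> [y]))"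
    by (rule linearI) (simp_all add: sigma_simps tau_simps A.ip_simps algebra_simps)
  then show "dual_app (fst (std_section (\<tau>, \<sigma>) x)) y = \<sigma> [x, y] - 1/2 * ip (\<tau> [x]) (\<tau> [y])"
    by (simp add: std_section_def dual_app_Abs)
qed (simp_all add: std_section_def)

lemma adapted_std_section: "adapted_section brl \<theta>l ip \<rho> \<theta>a D (std_section (\<tau>, \<sigma>))"
proof (rule D.adapted_sectionI)
  show "linear (std_section (\<tau>, \<sigma>))"
    by (rule linearI; rule triple_eqI)
      (simp_all add: std_section_comp sigma_simps tau_simps A.ip_simps dual_simps algebra_simps)
  show "ext_base D (std_section (\<tau>, \<sigma>) x) = x" for x
    by (simp add: std_base std_section_comp)
  show "qinv D (std_section (\<tau>, \<sigma>) x) = std_section (\<tau>, \<sigma>) (\<theta>l x)" for x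
    using tau_sigma_inv(2)[of x "\<theta>l _"]
    by (intro triple_eqI)
      (simp_all add: std_ext_sel std_inv_comp std_section_comp tau_sigma_inv ip_inv_shift L.inv_inv)
  show "qip D (std_section (\<tau>, \<sigma>) x) (std_section (\<tau>, \<sigma>) y) = 0" for x y
    using sigma_swap[of y x] by (simp add: std_ext_sel std_ip_comp std_section_comp A.ip_sym[of "\<tau> [y]"])
qed

text \<open>
  Changing the section changes the cocycle by the action of \<open>(\<tau>, \<sigma>)\<close>.  In the component \<open>\<gamma>\<close> the
  terms in \<open>\<sigma>\<close> give \<open>d \<sigma>\<close>, those pairing \<open>\<alpha>\<close> with \<open>\<tau>\<close> give \<open>\<langle>\<alpha> \<and> \<tau>\<rangle>\<close>, and those quadratic
  in \<open>\<tau>\<close> combine to \<open>1/2 \<langle>d \<tau> \<and> \<tau>\<rangle>\<close> because \<open>\<rho>\<close> is skew.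
\<close>

lemma section_cocycle_std_section:
  "section_cocycle brl D (std_section (\<tau>, \<sigma>)) = C1Q_act brl ip \<rho> (\<alpha>, \<gamma>) (\<tau>, \<sigma>)"
proof -
  interpret s: adapted_section brl \<theta>l ip \<rho> \<theta>a D "std_section (\<tau>, \<sigma>)"
    by (rule adapted_std_section)
  have t0: "\<tau> xs = 0" if "length xs \<noteq> 1" for xs
    using c that by (simp add: C1Q_iff cochains_wrong_length[of _ 1])
  have s0: "\<sigma> xs = 0" if "length xs \<noteq> 2" for xs
    using c that by (simp add: C1Q_iff cochains_wrong_length[of _ 2])
  have dt0: "ce_diff brl \<rho> \<tau> xs = 0" if "length xs \<noteq> 2" for xs
    using that by (intro ce_diff_wrong_length[of _ 1] t0) (simp_all add: rep_simps)
  define \<beta> where "\<beta> ys = \<alpha> ys + (1/2) *\<^sub>R ce_diff brl \<rho> \<tau> ys" for ys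
  have b0: "\<beta> xs = 0" if "length xs \<noteq> 2" for xs
    using that by (simp add: \<beta>_def dt0 cochains_wrong_length[OF alpha_cochain])
  have "s.\<alpha>s xs = \<alpha> xs + ce_diff brl \<rho> \<tau> xs" for xs
  proof (cases "length xs = 2")
    case True
    then obtain x y where xs: "xs = [x, y]" by (auto simp: list_len2)
    show ?thesis
      by (simp add: xs s.alpha_s std_fibre std_ext_sel std_br_comp' std_section_comp ce_diff_2)
  qed (simp add: dt0 cochains_wrong_length[OF alpha_cochain] cochains_wrong_length[OF s.C.alpha_cochain])
  moreover have "s.\<gamma>s xs = \<gamma> xs + ce_diff_triv brl \<sigma> xs + wedge ip \<beta> \<tau> xs" for xs
  proof (cases "length xs = 3")
    case True
    then obtain x y w where xs: "xs = [x, y, w]" by (auto simp: list_len3)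
    show ?thesis
      using rep_skew[of x "\<tau> [y]" "\<tau> [w]"] rep_skew[of y "\<tau> [x]" "\<tau> [w]"] rep_skew[of w "\<tau> [x]" "\<tau> [y]"]
      by (simp add: xs s.gamma_s std_ext_sel std_ip_comp std_br_comp' std_section_comp
          ce_diff_3 wedge_2_1[OF A.ip_bilinear b0] \<beta>_def ce_diff_2 A.ip_simps
          A.ip_sym[of "\<alpha> _" "\<tau> _"] A.ip_sym[of "\<rho> _ _" "\<tau> _"] A.ip_sym[of "\<tau> [brl _ _]" "\<tau> [x]"]
          A.ip_sym[of "\<tau> [brl _ _]" "\<tau> [y]"] A.ip_sym[of "\<tau> [brl _ _]" "\<tau> [w]"]
          sigma_swap[of "brl _ _"] add_divide_distrib diff_divide_distrib)
  next
    case False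
    then have "ce_diff_triv brl \<sigma> xs = 0"
      by (intro ce_diff_wrong_length[of _ 2] s0) simp_all
    moreover have "wedge ip \<beta> \<tau> xs = 0"
    proof (rule wedge_wrong_length[OF A.ip_bilinear b0 t0])
      show "length xs \<noteq> 2 + 1" using False by linarith
    qed
    ultimately show ?thesis
      using False by (simp add: cochains_wrong_length[OF gamma_cochain] cochains_wrong_length[OF s.C.gamma_cochain])
  qed
  ultimately show ?thesis
    by (simp add: C1Q_act_def prod_eq_iff fun_eq_iff \<beta>_def[abs_def])
qed

end

text \<open>
  Isotropy of the section says that \<open>\<sigma>\<close>, read off from its dual component, is alternating.
\<close>

lemma adapted_section_std:
  assumes "adapted_section brl \<theta>l ip \<rho> \<theta>a D s"
  shows "\<exists>c \<in> C1Q \<theta>l \<theta>a. s = std_section c"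
proof -
  interpret s: adapted_section brl \<theta>l ip \<rho> \<theta>a D s by fact
  define \<tau> where "\<tau> xs = (case xs of [x] \<Rightarrow> fst (snd (s x)) | _ \<Rightarrow> 0)" for xs
  define \<sigma> where "\<sigma> xs = (case xs of [x, y] \<Rightarrow> dual_app (fst (s x)) y + 1/2 * ip (\<tau> [x]) (\<tau> [y]) | _ \<Rightarrow> 0)" for xs
  have \<tau>: "\<tau> [x] = fst (snd (s x))" for x by (simp add: \<tau>_def)
  have \<sigma>: "\<sigma> [x, y] = dual_app (fst (s x)) y + 1/2 * ip (\<tau> [x]) (\<tau> [y])" for x y by (simp add: \<sigma>_def)
  have base: "snd (snd (s x)) = x" for x using s.s_base[of x] by (simp add: std_base)
  have iso: "dual_app (fst (s x)) y + dual_app (fst (s y)) x + ip (\<tau> [x]) (\<tau> [y]) = 0" for x y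
    using s.s_isotropic[of x y] by (simp add: std_ext_sel std_ip_comp base \<tau>)
  have inv: "s (\<theta>l x) = std_inv \<theta>l \<theta>a (s x)" for x
    using s.s_inv[of x] by (simp add: std_ext_sel)
  have "\<tau> \<in> cochains 1"
    unfolding cochains_1_iff
  proof (intro conjI allI impI)
    show "\<tau> xs = 0" if "length xs \<noteq> 1" for xs
      using that by (auto simp: \<tau>_def split: list.splits)
    show "linear (\<lambda>x. \<tau> [x])" by (rule linearI) (simp_all add: \<tau> s.s_simps)
  qed
  moreover have "\<sigma> \<in> cochains 2"
    unfolding cochains_2_iff
  proof (intro conjI allI impI)
    show "\<sigma> xs = 0" if "length xs \<noteq> 2" for xs
      using that by (auto simp: \<sigma>_def split: list.splits)
    show "bilinear (\<lambda>x y. \<sigma> [x, y])"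
      unfolding bilinear_def
      by (intro conjI allI linearI) (simp_all add: \<sigma> \<tau> s.s_simps linearity_simps algebra_simps)
    show "\<sigma> [x, x] = 0" for x using iso[of x x] by (simp add: \<sigma>)
  qed
  moreover have "\<tau> [\<theta>l x] = \<theta>a (\<tau> [x])" for x by (simp add: \<tau> inv std_inv_comp)
  moreover from this have "\<sigma> [\<theta>l x, \<theta>l y] = \<sigma> [x, y]" for x y
    by (simp add: \<sigma> inv std_inv_comp L.inv_inv mod_inv_isometry)
  ultimately have c: "(\<tau>, \<sigma>) \<in> C1Q \<theta>l \<theta>a" by (simp add: C1Q_iff)
  have "s x = std_section (\<tau>, \<sigma>) x" for x
    by (rule triple_eqI) (simp_all add: std_section_comp[OF c] \<sigma> \<tau> base)
  then show ?thesis using c by blast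
qed

end

section \<open>The classification\<close>

context orthogonal_module
begin

abbreviation "Z2 \<equiv> Z2Q brl \<theta>l ip \<rho> \<theta>a"
abbreviation "R \<equiv> orbit_rel brl \<theta>l ip \<rho> \<theta>a"
abbreviation "std \<equiv> std_ext brl \<theta>l ip \<rho> \<theta>a"

lemma quadratic_cocycleI: "(\<alpha>, \<gamma>) \<in> Z2 \<Longrightarrow> quadratic_cocycle brl \<theta>l ip \<rho> \<theta>a \<alpha> \<gamma>"
  by (simp add: quadratic_cocycle_def quadratic_cocycle_axioms_def) (simp add: Z2Q_iff)

lemma std_quad_ext: "z \<in> Z2 \<Longrightarrow> std z \<in> quad_exts brl \<theta>l ip \<rho> \<theta>a"
  using invariant_cochains.std_ext_is_quad_ext[of brl \<theta>l ip \<rho> \<theta>a "fst z" "snd z"] Z2Q_iff[of "fst z" "snd z"]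
  by (simp add: quad_exts_def)

text \<open>
  Both sides say that \<open>z'\<close> is the cocycle of an adapted section of the standard model of \<open>z\<close>.
\<close>

lemma orbit_rel_iff: "(z, z') \<in> R \<longleftrightarrow> z \<in> Z2 \<and> z' \<in> Z2 \<and> ext_equiv (std z) (std z')"
proof (cases "z \<in> Z2")
  case True
  obtain \<alpha> \<gamma> where z: "z = (\<alpha>, \<gamma>)" by (cases z)
  interpret quadratic_cocycle brl \<theta>l ip \<rho> \<theta>a \<alpha> \<gamma>
    using True by (intro quadratic_cocycleI) (simp add: z)
  have "(z, z') \<in> R \<longleftrightarrow> (\<exists>c \<in> C1Q \<theta>l \<theta>a. z' = C1Q_act brl ip \<rho> z c)"
    using True unfolding orbit_rel_def by blast
  also have "\<dots> \<longleftrightarrow> (\<exists>s. adapted_section brl \<theta>l ip \<rho> \<theta>a (std z) s \<and> z' = section_cocycle brl (std z) s)"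
    using adapted_std_section section_cocycle_std_section adapted_section_std
    unfolding z by (metis surj_pair)
  also have "\<dots> \<longleftrightarrow> z' \<in> Z2 \<and> ext_equiv (std z) (std z')"
    using adapted_section.section_cocycle_Z2Q[of brl \<theta>l ip \<rho> \<theta>a "std z"]
      adapted_section.ext_equiv_section_cocycle[of brl \<theta>l ip \<rho> \<theta>a "std z"]
      D.adapted_section_of_equiv[of z'] unfolding z by metis
  finally show ?thesis using True by simp
qed (auto simp: orbit_rel_def)

lemma ext_equiv_std:
  assumes "E \<in> quad_exts brl \<theta>l ip \<rho> \<theta>a"
  obtains z where "z \<in> Z2" "ext_equiv E (std z)"
proof -
  interpret quadratic_extension brl \<theta>l ip \<rho> \<theta>a E
    using assms by unfold_locales (simp add: quad_exts_def)
  obtain s where "adapted_section brl \<theta>l ip \<rho> \<theta>a E s" using adapted_section_exists ..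
  then interpret adapted_section brl \<theta>l ip \<rho> \<theta>a E s .
  show ?thesis using that section_cocycle_Z2Q ext_equiv_section_cocycle by blast
qed

lemma equiv_orbit_rel: "equiv Z2 R"
  by (rule equivI) (auto simp: refl_on_def sym_def trans_def orbit_rel_iff
      intro: ext_equiv_refl ext_equiv_sym ext_equiv_trans)

lemma equiv_ext_equiv_rel:
  "equiv (quad_exts brl \<theta>l ip \<rho> \<theta>a) (ext_equiv_rel brl \<theta>l ip \<rho> \<theta>a)"
  by (rule equivI) (auto simp: refl_on_def sym_def trans_def ext_equiv_rel_def
      intro: ext_equiv_refl ext_equiv_sym ext_equiv_trans)

end


text \<open>
  By \<open>orbit_rel_iff\<close> the map induced by \<open>z \<mapsto> std z\<close> on classes is well defined and injective, and
  adapted sections make it surjective.  The statement about an extension on an arbitrary vector space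
  follows in the same way, since equivalence compares extensions of different underlying types.
\<close>

theorem theorem4p1:
  fixes br :: "'l::real_vector \<Rightarrow> 'l \<Rightarrow> 'l"
    and \<theta>l :: "'l \<Rightarrow> 'l"
    and ip :: "'a::real_vector \<Rightarrow> 'a \<Rightarrow> real"
    and \<rho> :: "'l \<Rightarrow> 'a \<Rightarrow> 'a"
    and \<theta>a :: "'a \<Rightarrow> 'a"
  assumes "orthogonal_module br \<theta>l ip \<rho> \<theta>a"
  shows "(\<exists>F. bij_betw F
            (H2Q br \<theta>l ip \<rho> \<theta>a)
            ((quad_exts br \<theta>l ip \<rho> \<theta>a :: ('l dual \<times> 'a \<times> 'l, 'a, 'l) quad_ext set)
               // ext_equiv_rel br \<theta>l ip \<rho> \<theta>a) \<and>
          (\<forall>z \<in> Z2Q br \<theta>l ip \<rho> \<theta>a.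
             F (orbit_rel br \<theta>l ip \<rho> \<theta>a `` {z}) =
             ext_equiv_rel br \<theta>l ip \<rho> \<theta>a `` {std_ext br \<theta>l ip \<rho> \<theta>a z}))
       \<and> (\<forall>E :: ('g::real_vector, 'a, 'l) quad_ext.
            E \<in> quad_exts br \<theta>l ip \<rho> \<theta>a \<longrightarrow>
            (\<exists>!c. c \<in> H2Q br \<theta>l ip \<rho> \<theta>a \<and>
                  (\<forall>z \<in> c. ext_equiv E (std_ext br \<theta>l ip \<rho> \<theta>a z))))"

proof -
  interpret orthogonal_module br \<theta>l ip \<rho> \<theta>a by fact
  let ?X = "quad_exts br \<theta>l ip \<rho> \<theta>a :: ('l dual \<times> 'a \<times> 'l, 'a, 'l) quad_ext set"
  let ?Q = "ext_equiv_rel br \<theta>l ip \<rho> \<theta>a :: (('l dual \<times> 'a \<times> 'l, 'a, 'l) quad_ext \<times> ('l dual \<times> 'a \<times> 'l, 'a, 'l) quad_ext) set"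
  have eqR: "equiv Z2 R" by (rule equiv_orbit_rel)
  have eqQ: "equiv ?X ?Q" by (rule equiv_ext_equiv_rel)
  have R_Q: "(z, z') \<in> R \<longleftrightarrow> (std z, std z') \<in> ?Q" if "z \<in> Z2" "z' \<in> Z2" for z z'
    using that by (simp add: orbit_rel_iff ext_equiv_rel_def std_quad_ext)
  have H2Q: "H2Q br \<theta>l ip \<rho> \<theta>a = Z2 // R" by (simp add: H2Q_def)
  define F where "F c = ?Q `` (std ` c)" for c
  have F: "F (R `` {z}) = ?Q `` {std z}" if z: "z \<in> Z2" for z
  proof -
    have "?Q `` {std z'} = ?Q `` {std z}" if "(z, z') \<in> R" for z'
    proof -
      have "z' \<in> Z2" using that by (simp add: orbit_rel_iff)
      then have "(std z, std z') \<in> ?Q" using that R_Q[OF z] by simp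
      then show ?thesis by (rule equiv_class_eq[OF eqQ, symmetric])
    qed
    moreover have "(z, z) \<in> R" using z by (simp add: orbit_rel_iff ext_equiv_refl)
    ultimately show ?thesis unfolding F_def by blast
  qed
  have "bij_betw F (Z2 // R) (?X // ?Q)"
    unfolding bij_betw_def
  proof
    show "inj_on F (Z2 // R)"
    proof (rule inj_onI)
      fix c c' assume "c \<in> Z2 // R" "c' \<in> Z2 // R" and eq: "F c = F c'"
      then obtain z z' where z: "z \<in> Z2" "c = R `` {z}" "z' \<in> Z2" "c' = R `` {z'}"
        by (meson quotientE)
      then have "(std z, std z') \<in> ?Q"
        using eq by (simp add: F eq_equiv_class_iff[OF eqQ] std_quad_ext)
      then show "c = c'" using z by (simp add: R_Q[symmetric] equiv_class_eq[OF eqR])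
    qed
    show "F ` (Z2 // R) = ?X // ?Q"
    proof (intro equalityI subsetI)
      fix d assume "d \<in> F ` (Z2 // R)"
      then obtain z where "z \<in> Z2" "d = F (R `` {z})" by (auto elim!: quotientE)
      then show "d \<in> ?X // ?Q" by (simp add: F quotientI std_quad_ext)
    next
      fix d assume "d \<in> ?X // ?Q"
      then obtain E where E: "E \<in> ?X" "d = ?Q `` {E}" by (auto elim!: quotientE)
      obtain z where z: "z \<in> Z2" "ext_equiv E (std z)" by (rule ext_equiv_std[OF E(1)])
      then have "d = F (R `` {z})"
        unfolding F[OF z(1)] E(2) using E(1)
        by (intro equiv_class_eq[OF eqQ]) (simp add: ext_equiv_rel_def std_quad_ext)
      then show "d \<in> F ` (Z2 // R)" using z(1) by (simp add: quotientI)
    qed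
  qed
  moreover have "\<exists>!c. c \<in> Z2 // R \<and> (\<forall>z \<in> c. ext_equiv E (std z))"
    if E: "E \<in> quad_exts br \<theta>l ip \<rho> \<theta>a" for E :: "('g, 'a, 'l) quad_ext"
  proof -
    obtain z where z: "z \<in> Z2" "ext_equiv E (std z)" by (rule ext_equiv_std[OF E])
    show ?thesis
    proof (rule ex1I[of _ "R `` {z}"])
      show "R `` {z} \<in> Z2 // R \<and> (\<forall>z' \<in> R `` {z}. ext_equiv E (std z'))"
        using z ext_equiv_trans by (auto simp: quotientI orbit_rel_iff)
    next
      fix c assume c: "c \<in> Z2 // R \<and> (\<forall>z \<in> c. ext_equiv E (std z))"
      then obtain z' where z': "z' \<in> Z2" "c = R `` {z'}" by (auto elim!: quotientE)
      then have "z' \<in> c" using equiv_class_self[OF eqR] by simp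
      then have "ext_equiv (std z') (std z)"
        using c z(2) ext_equiv_sym ext_equiv_trans by blast
      then have "(z', z) \<in> R" using z(1) z'(1) by (simp add: orbit_rel_iff)
      then show "c = R `` {z}" unfolding z'(2) by (rule equiv_class_eq[OF eqR])
    qed
  qed
  ultimately show ?thesis
    unfolding H2Q using F by blast
qed

end
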